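(* Let $\varepsilon>0$. For every $\psi:\mathbb{N}\to\mathbb{R}_{\geq0}$ and $y\in\mathbb{R}$, \[ |\mathcal{A}^{y}_{2,1}(\psi)|=1\quad\text{if}\quad \sum_{q=1}^\infty\Bigl(\frac{\varphi(q)}{q}\Bigr)^{1+\varepsilon}q\,\psi(q)=\infty . \] For every $\psi:\mathbb{N}\to\mathbb{R}_{\geq0}$ and $\mathbf{y}\in\mathbb{R}^2$, \[ |\mathcal{A}^{\mathbf{y}}_{1,2}(\psi)|=1\quad\text{if}\quad \sum_{q=1}^\infty\Bigl(\frac{\varphi(q)}{q}\Bigr)^{1+\varepsilon}\psi(q)^2=\infty . \]
   Context: $\varphi$ is Euler's totient function. For $\mathbf{q}\in\mathbb{Z}^n$, $|\mathbf{q}|=\max_i|q_i|$; points $\mathbf{x}\in[0,1]^{nm}$ are $n\times m$ matrices and $\mathbf{q}\mathbf{x}$ is the row-vector–matrix product. $\mathcal{A}^{\mathbf{y}}_{n,m}(\psi)$ is the set of $\mathbf{x}\in[0,1]^{nm}$ such that for infinitely many $(\mathbf{p},\mathbf{q})\in\mathbb{Z}^m\times(\mathbb{Z}^n\setminus\{\mathbf0\})$, $\mathbf{q}\mathbf{x}+\mathbf{p}$ lies in the max-norm ball in $\mathbb{R}^m/\mathbb{Z}^m$ of centre $\mathbf{y}$ and radius $\psi(|\mathbf{q}|)$. $|\cdot|$ denotes Lebesgue measure. *)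

theory Defs
  imports "HOL-Analysis.Analysis" "HOL-Number_Theory.Number_Theory"
begin

definition int_vec_norm :: "int ^ 'n \<Rightarrow> nat" where
  "int_vec_norm q = nat (Max (range (\<lambda>i. \<bar>q $ i\<bar>)))"

definition unit_cube :: "(real ^ 'm ^ 'n) set" where
  "unit_cube = {x. \<forall>i j. 0 \<le> x $ i $ j \<and> x $ i $ j \<le> 1}"

definition approx_set :: "real ^ 'm \<Rightarrow> (nat \<Rightarrow> real) \<Rightarrow> (real ^ 'm ^ 'n) set" where
  "approx_set y \<psi> = {x \<in> unit_cube.
     infinite {pq :: (int ^ 'm) \<times> (int ^ 'n). let p = fst pq; q = snd pq in q \<noteq> 0 \<and>
        (\<forall>j. \<bar>(((\<chi> i. of_int (q $ i)) v* x) $ j) + of_int (p $ j) - y $ j\<bar>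
              < \<psi> (int_vec_norm q))}}"

end

theory Submission
  imports Defs "HOL-Probability.Probability"
begin

text \<open>
  Both parts rest on a second moment bound with the sharp leading constant: if
  \<open>\<Sum>\<^sub>i\<^sub>j P(E\<^sub>i \<inter> E\<^sub>j) \<le> (1 + e) S\<^sup>2\<close> with \<open>S = \<Sum>\<^sub>i P(E\<^sub>i)\<close>, then the union of the \<open>E\<^sub>i\<close> misses at most
  measure \<open>e\<close>. Arbitrarily small \<open>e\<close> gives full measure directly, with no zero-one law.

  For two variables and one form, only the primitive vectors \<open>(a, k)\<close> with \<open>1 \<le> a \<le> k\<close> are used. Any
  two of them are linearly independent, so the events are pairwise independent, and
  their probabilities add up to \<open>2 \<Sum> \<phi>(k) \<psi>(k)\<close>.

  For one variable and two forms, the overlap of the events for \<open>q \<le> r\<close> is at most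
  \<open>(4 \<psi>(q) \<psi>(r) + 2 \<psi>(r) gcd(q, r) / r)\<^sup>2\<close>, and \<open>\<Sum>\<^sub>q\<^sub>\<le>\<^sub>r (gcd(q, r) / r)\<^sup>2 \<le> r / \<phi>(r)\<close>. On a set of indices
  with \<open>r / \<phi>(r) \<le> H\<close> the error term is negligible once \<open>\<Sum> \<psi>(q)\<^sup>2\<close> is large compared with \<open>H\<close>. If this
  failed on every dyadic range of \<open>r / \<phi>(r)\<close>, the series with the exponent \<open>1 + \<epsilon>\<close> would converge.
\<close>

section \<open>The second moment criterion\<close>

text \<open>Chebyshev's argument: with \<open>X\<close> the number of events that occur,
  \<open>(X - S)\<^sup>2\<close> equals \<open>S\<^sup>2\<close> wherever none occurs, while its
  expectation is the second moment minus \<open>S\<^sup>2\<close>, hence at most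
  \<open>e * S\<^sup>2\<close>.\<close>

lemma (in prob_space) prob_no_event_le:
  assumes I: "finite I" and E: "\<And>i. i \<in> I \<Longrightarrow> E i \<in> events"
    and S: "0 < (\<Sum>i\<in>I. prob (E i))"
    and le: "(\<Sum>i\<in>I. \<Sum>j\<in>I. prob (E i \<inter> E j)) \<le> (1 + e) * (\<Sum>i\<in>I. prob (E i))\<^sup>2"
  shows "prob (space M - (\<Union>i\<in>I. E i)) \<le> e"
proof -
  define S where "S = (\<Sum>i\<in>I. prob (E i))"
  define X where "X = (\<lambda>x. \<Sum>i\<in>I. indicator (E i) x :: real)"
  define N where "N = space M - (\<Union>i\<in>I. E i)"
  have N: "N \<in> events" unfolding N_def using I E by auto
  have iX [intro, simp]: "integrable M X" unfolding X_def using E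
    by (intro Bochner_Integration.integrable_sum integrable_real_indicator) (auto simp: emeasure_eq_measure)
  have X2: "(X x)\<^sup>2 = (\<Sum>i\<in>I. \<Sum>j\<in>I. indicator (E i \<inter> E j) x)" for x
    by (simp add: X_def power2_eq_square sum_product indicator_inter_arith)
  have iX2 [simp]: "integrable M (\<lambda>x. (X x)\<^sup>2)" unfolding X2 using E
    by (intro Bochner_Integration.integrable_sum integrable_real_indicator) (auto simp: emeasure_eq_measure)
  have ind: "expectation (indicator A) = prob A" "integrable M (indicator A :: _ \<Rightarrow> real)" if "A \<in> events" for A
    using that by (auto intro!: integrable_real_indicator simp: emeasure_eq_measure)
  have eX: "expectation X = S" unfolding X_def S_def using E ind
    by (subst Bochner_Integration.integral_sum) auto
  have eX2: "expectation (\<lambda>x. (X x)\<^sup>2) = (\<Sum>i\<in>I. \<Sum>j\<in>I. prob (E i \<inter> E j))"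
  proof -
    have "E i \<inter> E j \<in> events" if "i \<in> I" "j \<in> I" for i j using E that by blast
    then show ?thesis unfolding X2 using ind
      by (subst Bochner_Integration.integral_sum, force)
         (intro sum.cong refl, subst Bochner_Integration.integral_sum, auto)
  qed
  have "S\<^sup>2 * prob N = expectation (\<lambda>x. S\<^sup>2 * indicator N x)" using N by simp
  also have "\<dots> \<le> expectation (\<lambda>x. (X x)\<^sup>2 - 2 * S * X x + S\<^sup>2)"
  proof (rule integral_mono)
    show "S\<^sup>2 * indicator N x \<le> (X x)\<^sup>2 - 2 * S * X x + S\<^sup>2" if "x \<in> space M" for x
    proof (cases "x \<in> N")
      case True
      then have "X x = 0" unfolding X_def N_def by (intro sum.neutral) auto
      then show ?thesis using True by simp
    next
      case False
      then show ?thesis using zero_le_power2[of "X x - S"] by (simp add: power2_diff algebra_simps)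
    qed
  qed (use N ind in \<open>auto intro!: Bochner_Integration.integrable_diff Bochner_Integration.integrable_add\<close>)
  also have "\<dots> = (\<Sum>i\<in>I. \<Sum>j\<in>I. prob (E i \<inter> E j)) - 2 * S * S + S\<^sup>2"
    by (simp add: eX eX2 prob_space)
  also have "\<dots> \<le> e * S\<^sup>2" using le unfolding S_def[symmetric] by (simp add: power2_eq_square algebra_simps)
  finally show ?thesis using S unfolding N_def S_def by (simp add: mult.commute)
qed

text \<open>A point lies in infinitely many events iff, for every finite \<open>F\<close>, it lies
  in one with index outside \<open>F\<close>; this is why \<open>moment\<close> asks for index sets
  avoiding a given \<open>F\<close>.\<close>

lemma (in prob_space) AE_infinitely_many_events:
  fixes E :: "'i::countable \<Rightarrow> 'a set"
  assumes E: "\<And>i. E i \<in> events"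
    and moment: "\<And>F e. finite F \<Longrightarrow> 0 < e \<Longrightarrow> \<exists>I. finite I \<and> I \<subseteq> J - F \<and> 0 < (\<Sum>i\<in>I. prob (E i)) \<and>
      (\<Sum>i\<in>I. \<Sum>j\<in>I. prob (E i \<inter> E j)) \<le> (1 + e) * (\<Sum>i\<in>I. prob (E i))\<^sup>2"
  shows "AE x in M. infinite {i\<in>J. x \<in> E i}"
proof -
  have "AE x in M. \<exists>i\<in>J - F. x \<in> E i" if F: "finite F" for F
  proof -
    define N where "N = space M - (\<Union>i\<in>J - F. E i)"
    have N: "N \<in> events" unfolding N_def using E by auto
    have "prob N \<le> e" if "0 < e" for e
    proof -
      obtain I where I: "finite I" "I \<subseteq> J - F" "0 < (\<Sum>i\<in>I. prob (E i))"
        "(\<Sum>i\<in>I. \<Sum>j\<in>I. prob (E i \<inter> E j)) \<le> (1 + e) * (\<Sum>i\<in>I. prob (E i))\<^sup>2"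
        using moment[OF F \<open>0 < e\<close>] by blast
      have "prob N \<le> prob (space M - (\<Union>i\<in>I. E i))"
        unfolding N_def using I E by (intro finite_measure_mono) auto
      also have "\<dots> \<le> e" using I E by (intro prob_no_event_le) auto
      finally show ?thesis .
    qed
    then have "prob N \<le> 0" by (rule field_le_epsilon[of _ 0, simplified])
    then have "N \<in> null_sets M" using N by (simp add: emeasure_eq_measure null_sets_def measure_le_0_iff)
    then show ?thesis by (rule AE_I') (auto simp: N_def)
  qed
  \<comment> \<open>A countable index type has only countably many finite subsets, so the
    exceptional null sets can be united.\<close>
  then have "AE x in M. \<forall>F\<in>Collect finite. \<exists>i\<in>J - F. x \<in> E i"
    by (subst AE_ball_countable) (auto intro: countable_Collect_finite)
  then show ?thesis
  proof eventually_elim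
    case (elim x)
    show ?case
    proof
      assume "finite {i\<in>J. x \<in> E i}"
      with elim obtain i where "i \<in> J - {i\<in>J. x \<in> E i}" "x \<in> E i" by blast
      then show False by simp
    qed
  qed
qed

section \<open>Periodic functions and the uniform distribution\<close>

text \<open>The shift moves the unit window to \<open>[c, c + 1)\<close>, which modulo integers is
  \<open>[d, d + 1)\<close> with \<open>d = frac c\<close>. The part beyond 1 moves back to
  \<open>[0, d)\<close> and completes \<open>[0, 1)\<close>.\<close>

lemma nn_integral_periodic_shift:
  fixes f :: "real \<Rightarrow> ennreal"
  assumes [measurable]: "f \<in> borel_measurable borel" and per: "\<And>x n. f (x + of_int n) = f x"
  shows "(\<integral>\<^sup>+x. f (x + c) * indicator {0..<1} x \<partial>lborel) = (\<integral>\<^sup>+x. f x * indicator {0..<1} x \<partial>lborel)"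
proof -
  define G where "G = (\<lambda>a b. \<integral>\<^sup>+x. f x * indicator {a..<b} x \<partial>lborel)"
  have shift: "G (a + of_int n) (b + of_int n) = G a b" for a b n
    unfolding G_def
    by (subst nn_integral_real_affine[where c=1 and t="of_int n"])
       (auto intro!: nn_integral_cong simp: per add.commute[of "of_int n"] indicator_def)
  have split: "G a b = G a c + G c b" if "a \<le> c" "c \<le> b" for a b c
    unfolding G_def using that
    by (subst nn_integral_add[symmetric]) (auto intro!: nn_integral_cong simp: indicator_def)
  define d where "d = frac c"
  have d: "0 \<le> d" "d \<le> 1" unfolding d_def using frac_lt_1[of c] by auto
  have c: "c = d + of_int \<lfloor>c\<rfloor>" by (simp add: d_def frac_def)
  have "(\<integral>\<^sup>+x. f (x + c) * indicator {0..<1} x \<partial>lborel) = G c (c + 1)"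
    unfolding G_def
    by (subst (2) nn_integral_real_affine[where c=1 and t=c])
       (auto intro!: nn_integral_cong simp: add.commute[of c] indicator_def)
  also have "\<dots> = G d (d + 1)" using shift[of d "\<lfloor>c\<rfloor>" "d + 1"] c by (simp add: algebra_simps)
  also have "\<dots> = G d 1 + G 1 (d + 1)" using d by (intro split) auto
  also have "G 1 (d + 1) = G 0 d" using shift[of 0 1 d] by simp
  also have "G d 1 + G 0 d = G 0 1" using split[of 0 d 1] d by (simp add: add.commute)
  finally show ?thesis by (simp add: G_def)
qed

text \<open>Each of the \<open>r\<close> pieces of length \<open>1 / r\<close> is stretched to the
  unit interval. This separates the position \<open>x\<close> inside a piece from the number
  \<open>j\<close> of the piece.\<close>

lemma nn_integral_subdivide:
  fixes h :: "real \<Rightarrow> ennreal"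
  assumes [measurable]: "h \<in> borel_measurable borel" and r: "0 < r"
  shows "(\<integral>\<^sup>+x. h x * indicator {0..<1} x \<partial>lborel) =
    (1 / real r) * (\<Sum>j<r. \<integral>\<^sup>+x. h ((x + real j) / real r) * indicator {0..<1} x \<partial>lborel)"
proof -
  define G where "G = (\<lambda>a b. \<integral>\<^sup>+x. h x * indicator {a..<b} x \<partial>lborel)"
  have split: "G a b = G a c + G c b" if "a \<le> c" "c \<le> b" for a b c
    unfolding G_def using that
    by (subst nn_integral_add[symmetric]) (auto intro!: nn_integral_cong simp: indicator_def)
  have sum: "G 0 (real n / real r) = (\<Sum>j<n. G (real j / real r) ((real j + 1) / real r))" for n
  proof (induction n)
    case 0
    then show ?case by (simp add: G_def)
  next
    case (Suc n)
    have "G 0 (real (Suc n) / real r) = G 0 (real n / real r) + G (real n / real r) (real (Suc n) / real r)"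
      by (rule split) (auto simp: divide_right_mono)
    then show ?case using Suc by (simp add: add.commute)
  qed
  have piece: "G (real j / real r) ((real j + 1) / real r) =
      (1 / real r) * (\<integral>\<^sup>+x. h ((x + real j) / real r) * indicator {0..<1} x \<partial>lborel)" for j
  proof -
    have aff: "real j / real r + 1 / real r * x = (x + real j) / real r" for x
      by (simp add: add_divide_distrib add.commute)
    have ind: "indicator {real j / real r..<(real j + 1) / real r} ((x + real j) / real r) =
        (indicator {0..<1} x :: ennreal)" for x
      using r by (simp add: indicator_def divide_le_cancel divide_less_cancel)
    show ?thesis unfolding G_def using r
      by (subst nn_integral_real_affine[where c="1 / real r" and t="real j / real r"])
         (simp_all only: aff ind, simp_all)
  qed
  have "G 0 1 = (1 / real r) * (\<Sum>j<r. \<integral>\<^sup>+x. h ((x + real j) / real r) * indicator {0..<1} x \<partial>lborel)"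
    using sum[of r] r by (simp add: piece sum_distrib_left)
  then show ?thesis unfolding G_def .
qed

section \<open>Uniform measure as a model of the circle and the torus\<close>

text \<open>The half-open interval holds exactly one representative of each class modulo 1, so on
  periodic integrands this acts as Haar measure of the circle.\<close>

definition unif :: "real measure" where
  "unif = density lborel (indicator {0..<1})"

lemma sets_unif [simp, measurable_cong]: "sets unif = sets borel"
  by (simp add: unif_def)

lemma space_unif [simp]: "space unif = UNIV"
  by (simp add: unif_def)

lemma nn_integral_unif:
  assumes "f \<in> borel_measurable borel"
  shows "(\<integral>\<^sup>+x. f x \<partial>unif) = (\<integral>\<^sup>+x. f x * indicator {0..<1} x \<partial>lborel)"
  using assms unfolding unif_def by (subst nn_integral_density) (auto simp: mult.commute)

lemma emeasure_unif:
  assumes "A \<in> sets borel"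
  shows "emeasure unif A = emeasure lborel ({0..<1} \<inter> A)"
  using assms unfolding unif_def
  by (subst emeasure_density) (auto simp: indicator_inter_arith[symmetric] Int_commute nn_integral_indicator)

interpretation unif: prob_space unif
  by (rule prob_spaceI) (simp add: emeasure_unif)

interpretation unif2: pair_prob_space unif unif ..

lemma sets_unif2 [simp]: "sets (unif \<Otimes>\<^sub>M unif) = sets (borel :: (real \<times> real) measure)"
  by (simp add: borel_prod[symmetric] cong: sets_pair_measure_cong)

lemma space_unif2 [simp]: "space (unif \<Otimes>\<^sub>M unif) = UNIV"
  by (simp add: space_pair_measure)

text \<open>Needed at the end, to read almost sure statements on the torus as Lebesgue almost
  everywhere statements on the square.\<close>

lemma unif2_eq_density: "unif \<Otimes>\<^sub>M unif = density lborel (indicator ({0..<1} \<times> {0..<1}))"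
proof -
  have "unif \<Otimes>\<^sub>M unif = density (lborel \<Otimes>\<^sub>M lborel) (\<lambda>(x, y). indicator {0..<1} x * indicator {0..<1} y)"
    unfolding unif_def using unif.sigma_finite_measure_axioms[unfolded unif_def]
    by (intro pair_measure_density) (auto simp: lborel.sigma_finite_measure_axioms)
  also have "(\<lambda>(x, y). indicator {0..<1} x * indicator {0..<1} y) =
      (indicator ({0..<1} \<times> {0..<1}) :: real \<times> real \<Rightarrow> ennreal)"
    by (auto simp: indicator_def fun_eq_iff)
  finally show ?thesis by (simp add: lborel_prod)
qed

lemma nn_integral_unif_shift:
  fixes f :: "real \<Rightarrow> ennreal"
  assumes [measurable]: "f \<in> borel_measurable borel" and per: "\<And>x n. f (x + of_int n) = f x"
  shows "(\<integral>\<^sup>+x. f (x + c) \<partial>unif) = (\<integral>\<^sup>+x. f x \<partial>unif)"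
  using nn_integral_periodic_shift[OF assms, of c] by (simp add: nn_integral_unif)

lemma nn_integral_unif_subdivide:
  fixes h :: "real \<Rightarrow> ennreal"
  assumes [measurable]: "h \<in> borel_measurable borel" and r: "0 < r"
  shows "(\<integral>\<^sup>+x. h x \<partial>unif) = (1 / real r) * (\<integral>\<^sup>+x. (\<Sum>j<r. h ((x + real j) / real r)) \<partial>unif)"
  using nn_integral_subdivide[OF assms]
  by (subst nn_integral_sum) (auto simp: nn_integral_unif)

text \<open>Multiplication by \<open>r\<close> preserves the measure of the circle: on piece
  \<open>j\<close> of the subdivision \<open>f (r * x)\<close> becomes
  \<open>f (x + j) = f x\<close>, and the \<open>r\<close> equal terms cancel the factor
  \<open>1 / r\<close>.\<close>

lemma nn_integral_unif_scale:
  fixes f :: "real \<Rightarrow> ennreal"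
  assumes [measurable]: "f \<in> borel_measurable borel" and per: "\<And>x n. f (x + of_int n) = f x" and r: "0 < r"
  shows "(\<integral>\<^sup>+x. f (real r * x) \<partial>unif) = (\<integral>\<^sup>+x. f x \<partial>unif)"
proof -
  have "f (x + real j) = f x" for x j using per[of x "int j"] by simp
  then have "(\<integral>\<^sup>+x. f (real r * x) \<partial>unif) = ennreal (1 / real r) * (\<integral>\<^sup>+x. of_nat r * f x \<partial>unif)"
    using r by (subst nn_integral_unif_subdivide[OF _ r]) auto
  also have "\<dots> = (\<integral>\<^sup>+x. f x \<partial>unif)"
    using r by (subst nn_integral_cmult)
      (auto simp: mult.assoc[symmetric] ennreal_of_nat_eq_real_of_nat ennreal_mult[symmetric])
  finally show ?thesis .
qed

section \<open>Balls on the circle and their overlaps under dilation\<close>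

text \<open>The open ball about \<open>y\<close> in R/Z, lifted to a periodic subset of the line so
  that real linear forms can be tested for membership directly.\<close>

definition near :: "real \<Rightarrow> real \<Rightarrow> real set" where
  "near y \<delta> = {t. \<exists>p::int. \<bar>t + of_int p - y\<bar> < \<delta>}"

lemma near_borel [measurable]: "near y \<delta> \<in> sets borel"
proof -
  have "near y \<delta> = (\<Union>p::int. {t. \<bar>t + of_int p - y\<bar> < \<delta>})" by (auto simp: near_def)
  moreover have "open (\<Union>p::int. {t::real. \<bar>t + of_int p - y\<bar> < \<delta>})"
    by (intro open_UN ballI open_Collect_less continuous_intros)
  ultimately show ?thesis by auto
qed

lemma near_periodic: "t + of_int n \<in> near y \<delta> \<longleftrightarrow> t \<in> near y \<delta>"
proof
  assume "t + of_int n \<in> near y \<delta>"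
  then obtain p where "\<bar>t + of_int n + of_int p - y\<bar> < \<delta>" unfolding near_def by auto
  then show "t \<in> near y \<delta>" unfolding near_def by (auto intro!: exI[of _ "n + p"] simp: add.assoc)
next
  assume "t \<in> near y \<delta>"
  then obtain p where "\<bar>t + of_int p - y\<bar> < \<delta>" unfolding near_def by auto
  then show "t + of_int n \<in> near y \<delta>" unfolding near_def by (auto intro!: exI[of _ "p - n"])
qed

lemma near_eq_UNIV:
  assumes "1 / 2 < \<delta>" shows "near y \<delta> = UNIV"
proof -
  have "\<bar>t + of_int (round (y - t)) - y\<bar> < \<delta>" for t
    using of_int_round_abs_le[of "y - t"] assms by (simp add: algebra_simps abs_minus_commute)
  then show ?thesis unfolding near_def by auto
qed

lemma emeasure_unif_near:
  assumes "0 \<le> \<delta>" "\<delta> \<le> 1 / 2"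
  shows "emeasure unif (near y \<delta>) = ennreal (2 * \<delta>)"
proof -
  \<comment> \<open>Moving the centre to 1/2 prevents the ball from wrapping around:
    \<open>x\<close> is within 1/2 of the centre and \<open>\<delta> \<le> 1 / 2\<close>, so only
    \<open>p = 0\<close> can occur.\<close>
  have eq: "{0..<1} \<inter> {x. x + (y - 1/2) \<in> near y \<delta>} = {1/2 - \<delta><..<1/2 + \<delta>}"
  proof (intro equalityI subsetI)
    fix x assume "x \<in> {0..<1} \<inter> {x. x + (y - 1/2) \<in> near y \<delta>}"
    then obtain p :: int where p: "\<bar>x - 1/2 + of_int p\<bar> < \<delta>" and x: "0 \<le> x" "x < 1"
      unfolding near_def by (auto simp: algebra_simps)
    have "\<bar>of_int p :: real\<bar> < 1" using p x assms by linarith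
    then have "p = 0" by linarith
    then show "x \<in> {1/2 - \<delta><..<1/2 + \<delta>}" using p by auto
  next
    fix x assume "x \<in> {1/2 - \<delta><..<1/2 + \<delta>}"
    then show "x \<in> {0..<1} \<inter> {x. x + (y - 1/2) \<in> near y \<delta>}"
      using assms unfolding near_def by (auto intro!: exI[of _ 0] simp: abs_less_iff)
  qed
  have "emeasure unif (near y \<delta>) = (\<integral>\<^sup>+x. indicator (near y \<delta>) x \<partial>unif)" by simp
  also have "\<dots> = (\<integral>\<^sup>+x. indicator (near y \<delta>) (x + (y - 1/2)) \<partial>unif)"
    by (rule nn_integral_unif_shift[symmetric]) (auto simp: near_periodic indicator_def)
  also have "\<dots> = (\<integral>\<^sup>+x. indicator {x. x + (y - 1/2) \<in> near y \<delta>} x \<partial>unif)"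
    by (intro nn_integral_cong) (simp add: indicator_def)
  also have "\<dots> = emeasure unif {x. x + (y - 1/2) \<in> near y \<delta>}"
    by (intro nn_integral_indicator) measurable
  also have "\<dots> = emeasure lborel {1/2 - \<delta><..<1/2 + \<delta>}"
    by (subst emeasure_unif) (simp_all only: eq, measurable)
  also have "\<dots> = ennreal (2 * \<delta>)" using assms by simp
  finally show ?thesis .
qed

lemma card_int_between_le:
  fixes a b :: real
  assumes "a \<le> b"
  shows "finite {n::int. a < of_int n \<and> of_int n < b}"
    and "real (card {n::int. a < of_int n \<and> of_int n < b}) \<le> b - a + 1"
proof -
  have sub: "{n::int. a < of_int n \<and> of_int n < b} \<subseteq> {\<lfloor>a\<rfloor> + 1..\<lceil>b\<rceil> - 1}"
    by auto linarith+
  show "finite {n::int. a < of_int n \<and> of_int n < b}"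
    using finite_subset[OF sub] by simp
  have "card {n::int. a < of_int n \<and> of_int n < b} \<le> nat (\<lceil>b\<rceil> - 1 - \<lfloor>a\<rfloor>)"
    using card_mono[OF _ sub] by simp
  moreover have "real_of_int (\<lceil>b\<rceil> - 1 - \<lfloor>a\<rfloor>) \<le> b - a + 1" by linarith
  ultimately show "real (card {n::int. a < of_int n \<and> of_int n < b}) \<le> b - a + 1"
    using assms by linarith
qed

text \<open>With \<open>d = gcd q r\<close>, the points \<open>q * j / r\<close> run modulo 1
  through the multiples of \<open>1 / r'\<close>, once in each of \<open>d\<close> blocks of length
  \<open>r'\<close>. A ball of radius \<open>\<delta>\<close> catches at most
  \<open>2 * \<delta> * r' + 1\<close> of them per block.\<close>

lemma card_near_multiples_le:
  assumes q: "0 < q" and r: "0 < r" and \<delta>: "0 \<le> \<delta>"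
  shows "real (card {j\<in>{..<r}. c + real q * real j / real r \<in> near y \<delta>}) \<le> 2 * \<delta> * real r + real (gcd q r)"
proof -
  define d where "d = gcd q r"
  have d: "0 < d" using q unfolding d_def by simp
  obtain q' r' where q': "q = q' * d" and r': "r = r' * d" and cop: "coprime q' r'"
    using gcd_coprime_exists[of q r] d unfolding d_def by blast
  have r'0: "0 < r'" using r r' by (metis gr0I mult_0)
  define A where "A = {j\<in>{..<r}. c + real q * real j / real r \<in> near y \<delta>}"
  define K where "K = {m::int. (y - c - \<delta>) * real r' < of_int m \<and> of_int m < (y - c + \<delta>) * real r'}"
  have le: "(y - c - \<delta>) * real r' \<le> (y - c + \<delta>) * real r'" using \<delta> by (intro mult_right_mono) auto
  have K: "finite K" "real (card K) \<le> 2 * \<delta> * real r' + 1"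
    using card_int_between_le[OF le] unfolding K_def by (auto simp: algebra_simps)
  have "\<forall>j\<in>A. \<exists>p::int. \<bar>c + real q * real j / real r + of_int p - y\<bar> < \<delta>"
    unfolding A_def near_def by auto
  then obtain p where p: "\<And>j. j \<in> A \<Longrightarrow> \<bar>c + real q * real j / real r + of_int (p j) - y\<bar> < \<delta>"
    by metis
  \<comment> \<open>The first component is \<open>r'\<close> times the shifted point
    \<open>q * j / r + p j\<close>: an integer in an interval of length
    \<open>2 * \<delta> * r'\<close> which, \<open>q'\<close> and \<open>r'\<close> being coprime,
    determines \<open>j mod r'\<close>. The second component names the block.\<close>
  define g where "g = (\<lambda>j. (int q' * int j + int r' * p j, j div r'))"
  have "g j \<in> K \<times> {..<d}" if "j \<in> A" for j
  proof -
    have e: "real q * real j / real r = real q' * real j / real r'"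
      using d by (simp add: q' r')
    have "of_int (int q' * int j + int r' * p j) = (real q * real j / real r + of_int (p j)) * real r'"
      unfolding e using r'0 by (simp add: field_simps)
    moreover have "y - c - \<delta> < real q * real j / real r + of_int (p j)"
      "real q * real j / real r + of_int (p j) < y - c + \<delta>"
      using p[OF that] by (auto simp: abs_less_iff)
    ultimately have "int q' * int j + int r' * p j \<in> K"
      unfolding K_def mem_Collect_eq using r'0 by (simp only:) simp
    moreover have "j div r' < d" using that r'0 unfolding A_def
      by (auto simp: r' less_mult_imp_div_less mult.commute)
    ultimately show ?thesis by (simp add: g_def)
  qed
  moreover have "inj_on g A"
  proof (rule inj_onI)
    fix i j assume "g i = g j"
    then have e: "int q' * int i + int r' * p i = int q' * int j + int r' * p j" and dv: "i div r' = j div r'"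
      by (auto simp: g_def)
    have "int q' * (int i - int j) = int r' * (p j - p i)" using e by (simp add: algebra_simps)
    then have "int r' dvd int q' * (int i - int j)" by simp
    then have "int r' dvd int i - int j"
      using cop by (metis coprime_commute coprime_dvd_mult_right_iff coprime_int_iff)
    then have "int i mod int r' = int j mod int r'" by (simp add: mod_eq_dvd_iff)
    then have "i mod r' = j mod r'" by (simp add: zmod_int[symmetric])
    then show "i = j" using dv by (metis div_mult_mod_eq)
  qed
  ultimately have "card A \<le> card (K \<times> {..<d})"
    using K
    by (intro card_inj_on_le[where f=g] image_subsetI finite_cartesian_product finite_lessThan) blast+
  then have "real (card A) \<le> real (card K) * real d"
    by (simp add: card_cartesian_product flip: of_nat_mult)
  also have "\<dots> \<le> (2 * \<delta> * real r' + 1) * real d" using K by (intro mult_right_mono) auto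
  also have "\<dots> = 2 * \<delta> * real r + real (gcd q r)"
    unfolding d_def[symmetric] by (simp add: r' algebra_simps)
  finally show ?thesis unfolding A_def .
qed

text \<open>Write \<open>x = (t + j) / r\<close> with \<open>j < r\<close>: the condition on \<open>r x\<close> depends only on \<open>t\<close>, and
  for fixed \<open>t\<close> the condition on \<open>q x\<close> selects few \<open>j\<close>.\<close>
lemma emeasure_unif_near_overlap_le:
  assumes q: "0 < q" and r: "0 < r" and \<delta>: "0 \<le> \<delta>" and \<eta>: "0 \<le> \<eta>" "\<eta> \<le> 1 / 2"
  shows "emeasure unif {x. real q * x \<in> near y \<delta> \<and> real r * x \<in> near y' \<eta>}
    \<le> ennreal (4 * \<delta> * \<eta> + 2 * \<eta> * real (gcd q r) / real r)"
proof -
  define h :: "real \<Rightarrow> ennreal"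
    where "h = indicator {x. real q * x \<in> near y \<delta> \<and> real r * x \<in> near y' \<eta>}"
  have [measurable]: "{x. real q * x \<in> near y \<delta> \<and> real r * x \<in> near y' \<eta>} \<in> sets borel" by measurable
  define C where "C = 2 * \<delta> * real r + real (gcd q r)"
  have C: "0 \<le> C" unfolding C_def using \<delta> by simp
  have "(\<Sum>j<r. h ((x + real j) / real r)) \<le> ennreal C * indicator (near y' \<eta>) x" for x
  proof -
    define A where "A = {j\<in>{..<r}. real q * x / real r + real q * real j / real r \<in> near y \<delta>}"
    have "x + real j \<in> near y' \<eta> \<longleftrightarrow> x \<in> near y' \<eta>" for j
      using near_periodic[of x "int j"] by simp
    then have "h ((x + real j) / real r) = indicator (near y' \<eta>) x * indicator A j" if "j < r" for j
      using r that unfolding h_def A_def by (auto simp: indicator_def add_divide_distrib distrib_left)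
    then have "(\<Sum>j<r. h ((x + real j) / real r)) = indicator (near y' \<eta>) x * (\<Sum>j<r. indicator A j)"
      by (simp add: sum_distrib_left)
    also have "(\<Sum>j<r. indicator A j) = (of_nat (card A) :: ennreal)"
    proof -
      have "{..<r} \<inter> {j. j \<in> A} = A" unfolding A_def by auto
      then show ?thesis by (simp add: indicator_def sum_of_bool_eq)
    qed
    moreover have "of_nat (card A) \<le> ennreal C"
      using card_near_multiples_le[OF q r \<delta>, of "real q * x / real r" y] 
      unfolding A_def C_def by (simp add: ennreal_of_nat_eq_real_of_nat ennreal_leI)
    ultimately show ?thesis by (simp add: mult.commute mult_right_mono)
  qed
  then have "(\<integral>\<^sup>+x. (\<Sum>j<r. h ((x + real j) / real r)) \<partial>unif) \<le> (\<integral>\<^sup>+x. ennreal C * indicator (near y' \<eta>) x \<partial>unif)"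
    by (intro nn_integral_mono) auto
  also have "\<dots> = ennreal C * ennreal (2 * \<eta>)"
    by (subst nn_integral_cmult_indicator) (auto simp: emeasure_unif_near[OF \<eta>])
  finally have "(\<integral>\<^sup>+x. h x \<partial>unif) \<le> ennreal (1 / real r) * (ennreal C * ennreal (2 * \<eta>))"
    using r by (subst nn_integral_unif_subdivide[OF _ r]) (auto simp: h_def intro: mult_left_mono)
  also have "\<dots> = ennreal (1 / real r * (C * (2 * \<eta>)))"
    using C \<eta> by (simp flip: ennreal_mult)
  also have "1 / real r * (C * (2 * \<eta>)) = 4 * \<delta> * \<eta> + 2 * \<eta> * real (gcd q r) / real r"
    using r by (simp add: C_def field_simps)
  finally show ?thesis unfolding h_def by simp
qed

text \<open>Shifting the arguments of \<open>f\<close> and \<open>g\<close> by any \<open>s\<close> and \<open>t\<close> amounts to a translation of the torus,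
  which leaves the integral unchanged; averaging over \<open>s\<close> and \<open>t\<close> then splits it.\<close>
lemma unif2_linear_independent:
  fixes f g :: "real \<Rightarrow> ennreal" and a b k l :: int
  assumes [measurable]: "f \<in> borel_measurable borel" "g \<in> borel_measurable borel"
    and perf: "\<And>x n. f (x + of_int n) = f x" and perg: "\<And>x n. g (x + of_int n) = g x"
    and det: "a * l \<noteq> b * k"
  shows "(\<integral>\<^sup>+z. f (a * fst z + k * snd z) * g (b * fst z + l * snd z) \<partial>(unif \<Otimes>\<^sub>M unif)) =
    (\<integral>\<^sup>+x. f x \<partial>unif) * (\<integral>\<^sup>+x. g x \<partial>unif)"
proof -
  define F where "F = (\<lambda>s t :: real. \<integral>\<^sup>+z. f (a * fst z + k * snd z + s) * g (b * fst z + l * snd z + t) \<partial>(unif \<Otimes>\<^sub>M unif))"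
  have F1: "F s t = (\<integral>\<^sup>+x1. \<integral>\<^sup>+x2. f (a * x1 + k * x2 + s) * g (b * x1 + l * x2 + t) \<partial>unif \<partial>unif)" for s t
    unfolding F_def by (subst unif.nn_integral_fst[symmetric]) auto
  have F2: "F s t = (\<integral>\<^sup>+x2. \<integral>\<^sup>+x1. f (a * x1 + k * x2 + s) * g (b * x1 + l * x2 + t) \<partial>unif \<partial>unif)" for s t
    unfolding F_def by (subst unif2.nn_integral_snd[symmetric]) auto
  \<comment> \<open>Since the coefficients are integers, the integrand is periodic in each variable
    separately, so either coordinate can be translated alone.\<close>
  have move2: "F (s + k * v) (t + l * v) = F s t" for s t v :: real
  proof -
    have "(\<integral>\<^sup>+x2. f (a * x1 + k * (x2 + v) + s) * g (b * x1 + l * (x2 + v) + t) \<partial>unif) =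
        (\<integral>\<^sup>+x2. f (a * x1 + k * x2 + s) * g (b * x1 + l * x2 + t) \<partial>unif)" for x1 :: real
    proof (rule nn_integral_unif_shift)
      fix x :: real and n :: int
      show "f (a * x1 + k * (x + n) + s) * g (b * x1 + l * (x + n) + t) =
          f (a * x1 + k * x + s) * g (b * x1 + l * x + t)"
        using perf[of "a * x1 + k * x + s" "k * n"] perg[of "b * x1 + l * x + t" "l * n"]
        by (simp add: algebra_simps)
    qed auto
    moreover have "F (s + k * v) (t + l * v) = (\<integral>\<^sup>+x1. \<integral>\<^sup>+x2.
        f (a * x1 + k * (x2 + v) + s) * g (b * x1 + l * (x2 + v) + t) \<partial>unif \<partial>unif)"
      unfolding F1 by (intro nn_integral_cong) (simp add: algebra_simps)
    ultimately show ?thesis unfolding F1 by simp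
  qed
  have move1: "F (s + a * u) (t + b * u) = F s t" for s t u :: real
  proof -
    have "(\<integral>\<^sup>+x1. f (a * (x1 + u) + k * x2 + s) * g (b * (x1 + u) + l * x2 + t) \<partial>unif) =
        (\<integral>\<^sup>+x1. f (a * x1 + k * x2 + s) * g (b * x1 + l * x2 + t) \<partial>unif)" for x2 :: real
    proof (rule nn_integral_unif_shift)
      fix x :: real and n :: int
      show "f (a * (x + n) + k * x2 + s) * g (b * (x + n) + l * x2 + t) =
          f (a * x + k * x2 + s) * g (b * x + l * x2 + t)"
        using perf[of "a * x + k * x2 + s" "a * n"] perg[of "b * x + l * x2 + t" "b * n"]
        by (simp add: algebra_simps)
    qed auto
    moreover have "F (s + a * u) (t + b * u) = (\<integral>\<^sup>+x2. \<integral>\<^sup>+x1.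
        f (a * (x1 + u) + k * x2 + s) * g (b * (x1 + u) + l * x2 + t) \<partial>unif \<partial>unif)"
      unfolding F2 by (intro nn_integral_cong) (simp add: algebra_simps)
    ultimately show ?thesis unfolding F2 by simp
  qed
  \<comment> \<open>Cramer's rule: the determinant is nonzero, so every pair of shifts
    \<open>(s, t)\<close> comes from some translation \<open>(u, v)\<close>.\<close>
  have const: "F s t = F 0 0" for s t
  proof -
    define D where "D = real_of_int (a * l - b * k)"
    have D: "D \<noteq> 0" using det unfolding D_def by (metis eq_iff_diff_eq_0 of_int_eq_0_iff)
    define u v where "u = (l * s - k * t) / D" and "v = (a * t - b * s) / D"
    have "a * u + k * v = D * s / D" "b * u + l * v = D * t / D"
      unfolding u_def v_def D_def by (simp_all add: add_divide_distrib[symmetric] algebra_simps)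
    then have "s = 0 + a * u + k * v" "t = 0 + b * u + l * v" using D by simp_all
    then show ?thesis using move1[of 0 u 0] move2[of "0 + a * u" v "0 + b * u"] by simp
  qed
  have "F 0 0 = (\<integral>\<^sup>+w. F 0 0 \<partial>(unif \<Otimes>\<^sub>M unif))"
    using unif2.emeasure_space_1 by simp
  also have "\<dots> = (\<integral>\<^sup>+w. F (fst w) (snd w) \<partial>(unif \<Otimes>\<^sub>M unif))"
    by (intro nn_integral_cong const[symmetric])
  \<comment> \<open>After Fubini the shifts are the inner variables; for each fixed \<open>z\<close>
    the inner integral is a product of one integral in \<open>s\<close> and one in
    \<open>t\<close>.\<close>
  also have "\<dots> = (\<integral>\<^sup>+z. \<integral>\<^sup>+w. f (a * fst z + k * snd z + fst w) * g (b * fst z + l * snd z + snd w)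
      \<partial>(unif \<Otimes>\<^sub>M unif) \<partial>(unif \<Otimes>\<^sub>M unif))"
    unfolding F_def
    by (rule pair_sigma_finite.Fubini') (auto intro!: pair_sigma_finite.intro unif2.sigma_finite_measure_axioms)
  also have "\<dots> = (\<integral>\<^sup>+z. (\<integral>\<^sup>+x. f x \<partial>unif) * (\<integral>\<^sup>+x. g x \<partial>unif) \<partial>(unif \<Otimes>\<^sub>M unif))"
  proof (intro nn_integral_cong)
    fix z :: "real \<times> real"
    define \<alpha> \<beta> where "\<alpha> = a * fst z + k * snd z" and "\<beta> = b * fst z + l * snd z"
    have "(\<integral>\<^sup>+w. f (\<alpha> + fst w) * g (\<beta> + snd w) \<partial>(unif \<Otimes>\<^sub>M unif)) =
        (\<integral>\<^sup>+s. \<integral>\<^sup>+t. f (\<alpha> + s) * g (\<beta> + t) \<partial>unif \<partial>unif)"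
      by (subst unif.nn_integral_fst[symmetric]) auto
    also have "\<dots> = (\<integral>\<^sup>+s. f (s + \<alpha>) \<partial>unif) * (\<integral>\<^sup>+t. g (t + \<beta>) \<partial>unif)"
      by (simp add: nn_integral_cmult nn_integral_multc add.commute)
    also have "\<dots> = (\<integral>\<^sup>+x. f x \<partial>unif) * (\<integral>\<^sup>+x. g x \<partial>unif)"
      using nn_integral_unif_shift[of f \<alpha>] nn_integral_unif_shift[of g \<beta>] perf perg by simp
    finally show "(\<integral>\<^sup>+w. f (a * fst z + k * snd z + fst w) * g (b * fst z + l * snd z + snd w) \<partial>(unif \<Otimes>\<^sub>M unif)) =
      (\<integral>\<^sup>+x. f x \<partial>unif) * (\<integral>\<^sup>+x. g x \<partial>unif)" unfolding \<alpha>_def \<beta>_def .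
  qed
  also have "\<dots> = (\<integral>\<^sup>+x. f x \<partial>unif) * (\<integral>\<^sup>+x. g x \<partial>unif)"
    using unif2.emeasure_space_1 by simp
  finally show ?thesis unfolding F_def by simp
qed

section \<open>Divisor sums and dyadic classes\<close>

text \<open>Stated for tails, so that large sums can be found beyond any finite set of
  indices.\<close>

lemma not_summable_imp_sum_ge:
  fixes f :: "nat \<Rightarrow> real"
  assumes nonneg: "\<And>n. 0 \<le> f n" and div: "\<not> summable f"
  shows "\<exists>K. C \<le> sum f {N..<K}"
proof (rule ccontr)
  assume "\<not> ?thesis"
  then have less: "sum f {N..<K} < C" for K by (simp add: not_le)
  have "sum f {..<n} \<le> sum f {..<N} + C" for n
  proof -
    have "sum f {..<n} \<le> sum f ({..<N} \<union> {N..<n})"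
      by (rule sum_mono2) (auto simp: nonneg)
    also have "\<dots> = sum f {..<N} + sum f {N..<n}"
      by (rule sum.union_disjoint) auto
    finally show ?thesis using less[of n] by linarith
  qed
  then have "summable f" by (rule summableI_nonneg_bounded[OF nonneg])
  with div show False by simp
qed

text \<open>The numbers \<open>e m \<le> r\<^sup>2\<close> with \<open>e dvd r\<close> and \<open>m\<close> coprime to \<open>r\<close> determine \<open>e\<close> and \<open>m\<close>; count them, with
  \<open>e = r div d\<close>.\<close>
lemma totient_mult_sum_divisors_le:
  assumes r: "0 < r"
  shows "totient r * (\<Sum>d | d dvd r. d) \<le> r\<^sup>2"
proof -
  \<comment> \<open>For each \<open>d\<close> the cofactor \<open>m\<close> is written as
    \<open>j * r + u\<close> with \<open>j < d\<close> and \<open>u\<close> a totative of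
    \<open>r\<close>, which gives \<open>d * totient r\<close> values.\<close>
  define T where "T = (SIGMA d : {d. d dvd r}. {..<d} \<times> totatives r)"
  define g where "g = (\<lambda>(d, j, u). (r div d) * (j * r + u))"
  have "inj_on g T"
  proof (rule inj_onI, clarsimp simp: T_def)
    fix d j u d' j' u'
    assume d: "d dvd r" "d' dvd r" and u: "u \<in> totatives r" "u' \<in> totatives r"
      and "g (d, j, u) = g (d', j', u')"
    then have eq: "(r div d) * (j * r + u) = (r div d') * (j' * r + u')" by (simp add: g_def)
    have rd: "r div d * d = r" "r div d' * d' = r" using d by simp_all
    then have e: "r div d dvd r" "r div d' dvd r" by (metis dvd_triv_left)+
    have "coprime r (j * r + u)" if "coprime u r" for j u :: nat
      using that by (metis coprime_commute coprime_iff_gcd_eq_1 gcd_add_mult)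
    then have cop: "coprime r (j * r + u)" "coprime r (j' * r + u')"
      using u by (auto simp: in_totatives_iff)
    \<comment> \<open>A divisor of \<open>r\<close> is coprime to both cofactors, so each of
      \<open>r div d\<close> and \<open>r div d'\<close> divides the other.\<close>
    have "r div d dvd r div d'"
    proof -
      have "coprime (r div d) (j' * r + u')" using e(1) cop(2) by (rule coprime_divisors[OF _ dvd_refl])
      moreover have "r div d dvd (r div d') * (j' * r + u')" by (simp flip: eq)
      ultimately show ?thesis by (simp add: coprime_dvd_mult_left_iff)
    qed
    moreover have "r div d' dvd r div d"
    proof -
      have "coprime (r div d') (j * r + u)" using e(2) cop(1) by (rule coprime_divisors[OF _ dvd_refl])
      moreover have "r div d' dvd (r div d) * (j * r + u)" by (simp add: eq)
      ultimately show ?thesis by (simp add: coprime_dvd_mult_left_iff)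
    qed
    ultimately have re: "r div d = r div d'" by (rule dvd_antisym)
    have re0: "0 < r div d" using d r by (metis dvd_div_mult_self gr0I mult_0)
    have dd: "d = d'"
    proof -
      have "(r div d) * d = (r div d) * d'" using rd re by metis
      then show ?thesis using re0 by simp
    qed
    have m: "j * r + u = j' * r + u'" using eq re re0 by simp
    \<comment> \<open>Totatives start at 1, and for \<open>r = 1\<close> the totative equals
      \<open>r\<close>; so \<open>u - 1\<close>, not \<open>u\<close>, serves as the remainder
      modulo \<open>r\<close>.\<close>
    have "u = Suc (u - 1)" "u' = Suc (u' - 1)" "u - 1 < r" "u' - 1 < r"
      using u by (auto simp: in_totatives_iff)
    moreover from this m have m': "j * r + (u - 1) = j' * r + (u' - 1)" by linarith
    moreover have "(i * r + w) div r = i" if "w < r" for i w :: nat using that by simp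
    ultimately have "j = j'" by metis
    then show "d = d' \<and> j = j' \<and> u = u'" using dd m by simp
  qed
  moreover have "g ` T \<subseteq> {1..r\<^sup>2}"
  proof (rule image_subsetI)
    fix t assume "t \<in> T"
    then obtain d j u where t: "t = (d, j, u)" and d: "d dvd r" and j: "j < d" and u: "u \<in> totatives r"
      unfolding T_def by auto
    have e: "0 < r div d" "r div d * d = r" using d r by (metis dvd_div_mult_self gr0I mult_0, simp)
    have "j * r + u \<le> (d - 1) * r + r" using j u by (intro add_mono mult_right_mono) (auto simp: in_totatives_iff)
    also have "\<dots> = d * r" using j by (cases d) auto
    finally have "(r div d) * (j * r + u) \<le> (r div d) * (d * r)" by (rule mult_left_mono) simp
    also have "\<dots> = r\<^sup>2" using e by (simp add: power2_eq_square mult.assoc[symmetric])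
    finally have "(r div d) * (j * r + u) \<le> r\<^sup>2" .
    moreover have "0 < (r div d) * (j * r + u)" using e u by (simp add: in_totatives_iff)
    ultimately show "g t \<in> {1..r\<^sup>2}" unfolding t g_def by (simp only: prod.case atLeastAtMost_iff less_eq_Suc_le One_nat_def)
  qed
  ultimately have "card T \<le> card {1..r\<^sup>2}" by (rule card_inj_on_le) simp
  moreover have "card T = totient r * (\<Sum>d | d dvd r. d)"
    unfolding T_def using r by (subst card_SigmaI) (auto simp: card_cartesian_product totient_def sum_distrib_left mult.commute)
  ultimately show ?thesis by simp
qed

text \<open>The square of the gcd is at most the sum of \<open>d\<^sup>2\<close> over common
  divisors \<open>d\<close>. After exchanging the sums, the \<open>r / d\<close> multiples of
  \<open>d\<close> up to \<open>r\<close> contribute \<open>r * d\<close>, and the divisor sum bound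
  applies.\<close>

lemma sum_gcd_square_le:
  assumes r: "0 < r"
  shows "totient r * (\<Sum>q=1..r. (gcd q r)\<^sup>2) \<le> r ^ 3"
proof -
  have fin: "finite {d. d dvd r}" using r by simp
  have "(\<Sum>q=1..r. (gcd q r)\<^sup>2) \<le> (\<Sum>q=1..r. \<Sum>d | d dvd r. if d dvd q then d\<^sup>2 else 0)"
  proof (rule sum_mono)
    fix q
    have "(gcd q r)\<^sup>2 = (\<Sum>d\<in>{gcd q r}. if d dvd q then d\<^sup>2 else 0)" by simp
    also have "\<dots> \<le> (\<Sum>d | d dvd r. if d dvd q then d\<^sup>2 else 0)"
      using fin by (intro sum_mono2) auto
    finally show "(gcd q r)\<^sup>2 \<le> (\<Sum>d | d dvd r. if d dvd q then d\<^sup>2 else 0)" .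
  qed
  also have "\<dots> = (\<Sum>d | d dvd r. \<Sum>q=1..r. if d dvd q then d\<^sup>2 else 0)" by (rule sum.swap)
  also have "\<dots> \<le> (\<Sum>d | d dvd r. r * d)"
  proof (rule sum_mono)
    fix d assume "d \<in> {d. d dvd r}"
    then obtain c where c: "r = d * c" by (auto elim: dvdE)
    have "{q\<in>{1..r}. d dvd q} \<subseteq> (*) d ` {1..c}"
      using r by (auto simp: c elim!: dvdE)
    then have "card {q\<in>{1..r}. d dvd q} \<le> card {1..c}" by (rule surj_card_le[rotated]) simp
    then have "d\<^sup>2 * card {q\<in>{1..r}. d dvd q} \<le> d\<^sup>2 * c" by simp
    also have "\<dots> = r * d" by (simp add: c power2_eq_square)
    finally show "(\<Sum>q=1..r. if d dvd q then d\<^sup>2 else 0) \<le> r * d"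
      by (simp add: sum.If_cases Int_def mult.commute)
  qed
  also have "\<dots> = r * (\<Sum>d | d dvd r. d)" by (simp add: sum_distrib_left)
  finally have "totient r * (\<Sum>q=1..r. (gcd q r)\<^sup>2) \<le> totient r * (r * (\<Sum>d | d dvd r. d))" by simp
  also have "\<dots> = r * (totient r * (\<Sum>d | d dvd r. d))" by simp
  also have "\<dots> \<le> r * r\<^sup>2" using totient_mult_sum_divisors_le[OF r] by simp
  finally show ?thesis by (simp add: power3_eq_cube power2_eq_square)
qed

lemma sum_gcd_square_real_le:
  assumes r: "0 < r" and I: "finite I" "0 \<notin> I"
  shows "(\<Sum>q | q \<in> I \<and> q \<le> r. (real (gcd q r) / real r)\<^sup>2) \<le> real r / real (totient r)"
proof -
  have "(\<Sum>q | q \<in> I \<and> q \<le> r. (real (gcd q r) / real r)\<^sup>2) \<le> (\<Sum>q=1..r. (real (gcd q r) / real r)\<^sup>2)"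
    using I by (intro sum_mono2) (auto simp: Suc_le_eq intro: gr0I)
  also have "\<dots> = real (\<Sum>q=1..r. (gcd q r)\<^sup>2) / (real r)\<^sup>2"
    by (simp add: power_divide sum_divide_distrib)
  also have "\<dots> \<le> real r / real (totient r)"
  proof -
    have "real (totient r) * real (\<Sum>q=1..r. (gcd q r)\<^sup>2) \<le> real r ^ 3"
      using sum_gcd_square_le[OF r] by (metis of_nat_le_iff of_nat_mult of_nat_power)
    then have "real (totient r) * real (\<Sum>q=1..r. (gcd q r)\<^sup>2) \<le> real r * (real r)\<^sup>2"
      by (simp add: power3_eq_cube power2_eq_square)
    moreover have "0 < real (totient r)" using r by simp
    ultimately show ?thesis using r
      by (simp add: field_simps)
  qed
  finally show ?thesis .
qed

text \<open>The values of \<open>1 / a\<close> are sorted into dyadic classes; the spare factor \<open>a powr \<epsilon>\<close> makes the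
  sum over the classes geometric.\<close>
lemma dyadic_class_sum_large:
  fixes a f :: "nat \<Rightarrow> real"
  assumes \<epsilon>: "0 < \<epsilon>" and C: "0 < C" and f: "\<And>q. 0 \<le> f q"
    and a: "\<And>q. 0 < q \<Longrightarrow> 0 < a q" "\<And>q. 0 < q \<Longrightarrow> a q \<le> 1"
    and div: "\<not> summable (\<lambda>q. a q powr (1 + \<epsilon>) * f q)" and N: "0 < N"
  shows "\<exists>I H. finite I \<and> I \<subseteq> {N..} \<and> 0 < H \<and> (\<forall>q\<in>I. 1 / a q \<le> H) \<and> H * C \<le> sum f I"
proof (rule ccontr)
  assume contra: "\<not> ?thesis"
  have small: "sum f I < H * C"
    if "finite I" "I \<subseteq> {N..}" "0 < H" "\<forall>q\<in>I. 1 / a q \<le> H" for I H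
    using that contra by (meson not_le)
  \<comment> \<open>The ratio of the geometric series: the gain from the exponent
    \<open>\<epsilon>\<close> on passing to the next dyadic class.\<close>
  define \<rho> where "\<rho> = 2 powr (- \<epsilon>)"
  have \<rho>: "0 < \<rho>" "\<rho> < 1" unfolding \<rho>_def using \<epsilon> by (auto simp: powr_less_one)
  define k where "k = (\<lambda>q. nat \<lfloor>log 2 (1 / a q)\<rfloor>)"
  have k: "2 ^ k q \<le> 1 / a q" "1 / a q \<le> 2 ^ (k q + 1)" if "0 < q" for q
  proof -
    have l: "0 \<le> log 2 (1 / a q)" using a[OF that] by (simp add: zero_le_log_cancel_iff)
    have "real (k q) \<le> log 2 (1 / a q)" "log 2 (1 / a q) \<le> real (k q + 1)"
      unfolding k_def using l by linarith+
    then have "2 powr real (k q) \<le> 1 / a q" "1 / a q \<le> 2 powr real (k q + 1)"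
      using a[OF that] by (simp_all add: le_log_iff log_le_iff)
    then show "2 ^ k q \<le> 1 / a q" "1 / a q \<le> 2 ^ (k q + 1)"
      by (simp_all only: powr_realpow zero_less_numeral)
  qed
  have weight: "a q powr (1 + \<epsilon>) \<le> \<rho> ^ k q / 2 ^ k q" if "0 < q" for q
  proof -
    have "a q \<le> 1 / 2 ^ k q" using k(1)[OF that] a[OF that] by (simp add: field_simps)
    then have "a q powr (1 + \<epsilon>) \<le> (1 / 2 ^ k q) powr (1 + \<epsilon>)"
      using a[OF that] \<epsilon> by (intro powr_mono2) auto
    also have "\<dots> = (2 powr (- real (k q))) powr (1 + \<epsilon>)"
      by (simp add: powr_minus powr_realpow divide_inverse)
    also have "\<dots> = 2 powr (- \<epsilon> * real (k q)) * 2 powr (- real (k q))"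
      unfolding powr_powr powr_add[symmetric] by (simp add: algebra_simps)
    also have "\<dots> = \<rho> ^ k q / 2 ^ k q"
      unfolding \<rho>_def by (simp add: powr_powr[symmetric] powr_realpow powr_minus divide_inverse power_inverse)
    finally show ?thesis .
  qed
  have bound: "(\<Sum>q=N..<n. a q powr (1 + \<epsilon>) * f q) \<le> 2 * C / (1 - \<rho>)" for n
  proof -
    define M where "M = Max (insert 0 (k ` {N..<n}))"
    have M: "k ` {N..<n} \<subseteq> {..M}" unfolding M_def by auto
    have "(\<Sum>q=N..<n. a q powr (1 + \<epsilon>) * f q)
        = (\<Sum>m\<le>M. \<Sum>q | q \<in> {N..<n} \<and> k q = m. a q powr (1 + \<epsilon>) * f q)"
      using M by (subst sum.group) auto
    also have "\<dots> \<le> (\<Sum>m\<le>M. 2 * C * \<rho> ^ m)"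
    proof (rule sum_mono)
      fix m
      define I where "I = {q. q \<in> {N..<n} \<and> k q = m}"
      have pos: "0 < q" if "q \<in> I" for q using that N unfolding I_def by auto
      have "(\<Sum>q\<in>I. a q powr (1 + \<epsilon>) * f q) \<le> (\<Sum>q\<in>I. \<rho> ^ m / 2 ^ m * f q)"
        using weight pos f by (intro sum_mono mult_right_mono) (auto simp: I_def)
      also have "\<dots> = \<rho> ^ m / 2 ^ m * sum f I" by (simp add: sum_distrib_left)
      \<comment> \<open>On class \<open>m\<close> the bound \<open>H = 2 ^ (m + 1)\<close> is valid.
        It cancels the \<open>2 ^ m\<close> in the weight up to a factor 2 and leaves the geometric
        term.\<close>
      also have "\<dots> \<le> \<rho> ^ m / 2 ^ m * (2 ^ (m + 1) * C)"
        using small[of I "2 ^ (m + 1)"] k(2) pos \<rho>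
        by (intro mult_left_mono less_imp_le) (auto simp: I_def)
      also have "\<dots> = 2 * C * \<rho> ^ m" by simp
      finally show "(\<Sum>q | q \<in> {N..<n} \<and> k q = m. a q powr (1 + \<epsilon>) * f q) \<le> 2 * C * \<rho> ^ m"
        unfolding I_def .
    qed
    also have "\<dots> = 2 * C * (\<Sum>m\<le>M. \<rho> ^ m)" by (simp add: sum_distrib_left)
    also have "(\<Sum>m\<le>M. \<rho> ^ m) \<le> (\<Sum>m. \<rho> ^ m)"
      using \<rho> by (intro sum_le_suminf summable_geometric) auto
    also have "(\<Sum>m. \<rho> ^ m) = 1 / (1 - \<rho>)" using \<rho> by (intro suminf_geometric) auto
    finally show ?thesis using C by simp
  qed
  obtain K where "2 * C / (1 - \<rho>) + 1 \<le> (\<Sum>q=N..<K. a q powr (1 + \<epsilon>) * f q)"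
    using not_summable_imp_sum_ge[OF _ div] f by (metis mult_nonneg_nonneg powr_ge_zero)
  with bound[of K] show False by linarith
qed

section \<open>Limsup sets on the unit square\<close>

abbreviation unif2 :: "(real \<times> real) measure" where
  "unif2 \<equiv> unif \<Otimes>\<^sub>M unif"

section \<open>Two variables, one linear form\<close>

lemma linear_near_event [measurable]:
  "{z. a * fst z + b * snd z \<in> near y \<delta>} \<in> sets unif2"
proof -
  have "{z \<in> space unif2. a * fst z + b * snd z \<in> near y \<delta>} \<in> sets unif2" by measurable
  then show ?thesis by (simp only: space_unif2 UNIV_I simp_thms)
qed

lemma prob_linear_near_Int:
  fixes a b k l :: int
  assumes "a * l \<noteq> b * k" and \<delta>: "0 \<le> \<delta>" "\<delta> \<le> 1 / 2" and \<eta>: "0 \<le> \<eta>" "\<eta> \<le> 1 / 2"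
  shows "measure unif2 ({z. a * fst z + k * snd z \<in> near y \<delta>} \<inter> {z. b * fst z + l * snd z \<in> near y' \<eta>})
    = 2 * \<delta> * (2 * \<eta>)" (is "measure unif2 (?A \<inter> ?B) = _")
proof -
  have "emeasure unif2 (?A \<inter> ?B) = (\<integral>\<^sup>+z. indicator (?A \<inter> ?B) z \<partial>unif2)"
    by (intro nn_integral_indicator[symmetric] sets.Int linear_near_event)
  also have "\<dots> = (\<integral>\<^sup>+z. indicator (near y \<delta>) (a * fst z + k * snd z) *
      indicator (near y' \<eta>) (b * fst z + l * snd z) \<partial>unif2)"
    by (intro nn_integral_cong) (simp add: indicator_def)
  also have "\<dots> = (\<integral>\<^sup>+x. indicator (near y \<delta>) x \<partial>unif) * (\<integral>\<^sup>+x. indicator (near y' \<eta>) x \<partial>unif)"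
    by (rule unif2_linear_independent) (auto simp: assms near_periodic indicator_def)
  also have "\<dots> = ennreal (2 * \<delta> * (2 * \<eta>))"
    using \<delta> \<eta> by (subst ennreal_mult) (simp_all add: emeasure_unif_near)
  finally show ?thesis using \<delta> \<eta> by (simp add: measure_def)
qed

lemma prob_linear_near:
  fixes a k :: int
  assumes "a \<noteq> 0" and \<delta>: "0 \<le> \<delta>" "\<delta> \<le> 1 / 2"
  shows "measure unif2 {z. a * fst z + k * snd z \<in> near y \<delta>} = 2 * \<delta>"
proof -
  have "emeasure unif2 {z. a * fst z + k * snd z \<in> near y \<delta>} =
      (\<integral>\<^sup>+z. indicator (near y \<delta>) (a * fst z + k * snd z) * 1 \<partial>unif2)"
    by (subst nn_integral_indicator[symmetric, OF linear_near_event])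
       (auto intro!: nn_integral_cong simp: indicator_def)
  \<comment> \<open>A single form is paired with the constant function 1 along the vector
    \<open>(0, 1)\<close>; the determinant is then \<open>a\<close>.\<close>
  also have "\<dots> = (\<integral>\<^sup>+x. indicator (near y \<delta>) x \<partial>unif) * (\<integral>\<^sup>+x. 1 \<partial>unif)"
    using unif2_linear_independent[of "indicator (near y \<delta>)" "\<lambda>_. 1" a 1 0 k] assms
    by (simp add: near_periodic indicator_def)
  also have "\<dots> = ennreal (2 * \<delta>)"
    using \<delta> unif.emeasure_space_1 by (simp add: emeasure_unif_near)
  finally show ?thesis using \<delta> by (simp add: measure_def)
qed

lemma AE_infinite_linear_forms_le_half:
  fixes \<psi> :: "nat \<Rightarrow> real"
  assumes \<psi>: "\<And>q. 0 \<le> \<psi> q" "\<And>q. \<psi> q \<le> 1 / 2"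
    and div: "\<not> summable (\<lambda>q. real (totient q) * \<psi> q)"
  shows "AE z in unif2. infinite {i\<in>{(a, k). a \<in> totatives k}.
    z \<in> {z. real (fst i) * fst z + real (snd i) * snd z \<in> near y (\<psi> (snd i))}}"
proof (rule unif2.P.AE_infinitely_many_events)
  define E where "E = (\<lambda>i :: nat \<times> nat. {z. real (fst i) * fst z + real (snd i) * snd z \<in> near y (\<psi> (snd i))})"
  fix F :: "(nat \<times> nat) set" and e :: real
  assume F: "finite F" and e: "0 < e"
  define N where "N = Suc (Max (insert 0 (snd ` F)))"
  have N: "snd i < N" if "i \<in> F" for i
    unfolding N_def less_Suc_eq_le using F that by (intro Max_ge) auto
  \<comment> \<open>The bound \<open>1 / e\<close> makes \<open>S\<close> at most
    \<open>e * S\<^sup>2\<close>, which absorbs the diagonal of the second moment.\<close>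
  obtain K where K: "1 / e + 1 \<le> (\<Sum>k=N..<K. real (totient k) * \<psi> k)"
    using not_summable_imp_sum_ge[OF _ div] \<psi> by (metis mult_nonneg_nonneg of_nat_0_le_iff)
  define I where "I = (\<lambda>(k, a). (a, k)) ` (SIGMA k : {N..<K}. totatives k)"
  have I: "finite I" unfolding I_def by auto
  have sub: "I \<subseteq> {(a, k). a \<in> totatives k} - F"
    unfolding I_def using N by fastforce
  have single: "measure unif2 (E i) = 2 * \<psi> (snd i)" if "i \<in> I" for i
    using prob_linear_near[of "int (fst i)" "\<psi> (snd i)" "int (snd i)" y] \<psi> sub that
    by (auto simp: E_def in_totatives_iff)
  have pair: "measure unif2 (E i \<inter> E j) =
      measure unif2 (E i) * measure unif2 (E j)" if ij: "i \<in> I" "j \<in> I" "i \<noteq> j" for i j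
  proof -
    obtain a k b l where i: "i = (a, k)" and j: "j = (b, l)" by (cases i, cases j)
    have cop: "coprime a k" "coprime b l" "0 < k" "0 < l"
      using sub ij i j by (auto simp: in_totatives_iff)
    \<comment> \<open>Proportional primitive vectors coincide: coprimality turns
      \<open>a * l = b * k\<close> into mutual divisibility of \<open>k\<close> and
      \<open>l\<close>.\<close>
    have "a * l \<noteq> b * k"
    proof
      assume eq: "a * l = b * k"
      have "k dvd l" using eq cop by (metis coprime_commute coprime_dvd_mult_right_iff dvd_triv_right)
      moreover have "l dvd k" using eq cop by (metis coprime_commute coprime_dvd_mult_right_iff dvd_triv_right)
      ultimately have "k = l" by (rule dvd_antisym)
      then show False using eq cop ij i j by simp
    qed
    then have "int a * int l \<noteq> int b * int k" by (metis of_nat_eq_iff of_nat_mult)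
    from prob_linear_near_Int[OF this \<psi>[of k] \<psi>[of l], of y y] show ?thesis
      using single[OF ij(1)] single[OF ij(2)] by (simp add: E_def i j)
  qed
  define S where "S = (\<Sum>i\<in>I. measure unif2 (E i))"
  have "S = (\<Sum>i\<in>I. 2 * \<psi> (snd i))" unfolding S_def using single by simp
  also have "\<dots> = (\<Sum>(k, a)\<in>(SIGMA k : {N..<K}. totatives k). 2 * \<psi> k)"
    unfolding I_def by (subst sum.reindex) (auto simp: inj_on_def intro!: sum.cong)
  also have "\<dots> = (\<Sum>k=N..<K. 2 * (real (totient k) * \<psi> k))"
    by (subst sum.Sigma[symmetric]) (auto simp: totient_def mult.left_commute)
  also have "\<dots> = 2 * (\<Sum>k=N..<K. real (totient k) * \<psi> k)" by (simp add: sum_distrib_left)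
  finally have Slarge: "1 / e + 1 \<le> S" using K e by (smt (verit) divide_nonneg_nonneg)
  then have Spos: "0 < S" using e by (smt (verit) divide_nonneg_nonneg)
  \<comment> \<open>On the diagonal the probability is relaxed by adding its own square, so that the
    products complete to \<open>S\<^sup>2\<close>.\<close>
  have "(\<Sum>i\<in>I. \<Sum>j\<in>I. measure unif2 (E i \<inter> E j)) \<le>
      (\<Sum>i\<in>I. \<Sum>j\<in>I. measure unif2 (E i) * measure unif2 (E j) + (if i = j then measure unif2 (E i) else 0))"
    using pair by (intro sum_mono) (auto simp: add_nonneg_nonneg)
  also have "\<dots> = S\<^sup>2 + S"
    using I by (simp add: sum.distrib S_def power2_eq_square sum_product)
  also have "\<dots> \<le> (1 + e) * S\<^sup>2"
  proof -
    have "1 \<le> e * S" using Slarge e by (simp add: field_simps)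
    then have "S * 1 \<le> S * (e * S)" using Spos by (intro mult_left_mono) auto
    then show ?thesis by (simp add: power2_eq_square algebra_simps)
  qed
  finally show "\<exists>I. finite I \<and> I \<subseteq> {(a, k). a \<in> totatives k} - F \<and>
      0 < (\<Sum>i\<in>I. measure unif2 {z. real (fst i) * fst z + real (snd i) * snd z \<in> near y (\<psi> (snd i))}) \<and>
      (\<Sum>i\<in>I. \<Sum>j\<in>I. measure unif2 ({z. real (fst i) * fst z + real (snd i) * snd z \<in> near y (\<psi> (snd i))} \<inter>
        {z. real (fst j) * fst z + real (snd j) * snd z \<in> near y (\<psi> (snd j))}))
      \<le> (1 + e) * (\<Sum>i\<in>I. measure unif2 {z. real (fst i) * fst z + real (snd i) * snd z \<in> near y (\<psi> (snd i))})\<^sup>2"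
    using I sub Spos unfolding S_def E_def by blast
qed (rule linear_near_event)

section \<open>One variable, two linear forms\<close>

lemma near_scale_borel [measurable]: "{x. real q * x \<in> near y \<delta>} \<in> sets borel"
  by measurable

lemma emeasure_unif_near_scale:
  assumes "0 < q" "0 \<le> \<delta>" "\<delta> \<le> 1 / 2"
  shows "emeasure unif {x. real q * x \<in> near y \<delta>} = ennreal (2 * \<delta>)"
proof -
  have "emeasure unif {x. real q * x \<in> near y \<delta>} = (\<integral>\<^sup>+x. indicator {x. real q * x \<in> near y \<delta>} x \<partial>unif)"
    by (intro nn_integral_indicator[symmetric]) simp
  also have "\<dots> = (\<integral>\<^sup>+x. indicator (near y \<delta>) (real q * x) \<partial>unif)"
    by (intro nn_integral_cong) (simp add: indicator_def)
  also have "\<dots> = (\<integral>\<^sup>+x. indicator (near y \<delta>) x \<partial>unif)"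
    using assms by (intro nn_integral_unif_scale) (auto simp: near_periodic indicator_def)
  finally show ?thesis using assms by (simp add: emeasure_unif_near)
qed

text \<open>The product form makes probabilities and intersections factor over the two
  coordinates.\<close>

definition simul :: "real \<Rightarrow> real \<Rightarrow> (nat \<Rightarrow> real) \<Rightarrow> nat \<Rightarrow> (real \<times> real) set" where
  "simul y y' \<psi> q = {x. real q * x \<in> near y (\<psi> q)} \<times> {x. real q * x \<in> near y' (\<psi> q)}"

lemma sets_simul: "simul y y' \<psi> q \<in> sets unif2"
  unfolding simul_def by (intro pair_measureI) auto

lemma prob_simul:
  assumes "0 < q" "0 \<le> \<psi> q" "\<psi> q \<le> 1 / 2"
  shows "measure unif2 (simul y y' \<psi> q) = 4 * (\<psi> q)\<^sup>2"
proof -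
  have "emeasure unif2 (simul y y' \<psi> q) = ennreal (2 * \<psi> q) * ennreal (2 * \<psi> q)"
    unfolding simul_def using assms by (subst unif.emeasure_pair_measure_Times) (auto simp: emeasure_unif_near_scale)
  also have "\<dots> = ennreal (2 * \<psi> q * (2 * \<psi> q))" using assms by (intro ennreal_mult[symmetric]) auto
  finally show ?thesis using assms by (simp add: measure_def power2_eq_square)
qed

lemma prob_simul_Int_le:
  assumes q: "0 < q" and r: "0 < r" and \<psi>: "0 \<le> \<psi> q" "0 \<le> \<psi> r" "\<psi> r \<le> 1 / 2"
  shows "measure unif2 (simul y y' \<psi> q \<inter> simul y y' \<psi> r)
    \<le> (4 * \<psi> q * \<psi> r + 2 * \<psi> r * real (gcd q r) / real r)\<^sup>2"
proof -
  define c where "c = 4 * \<psi> q * \<psi> r + 2 * \<psi> r * real (gcd q r) / real r"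
  have c: "0 \<le> c" unfolding c_def using \<psi> by simp
  have [measurable]: "{x. real q * x \<in> near y (\<psi> q) \<and> real r * x \<in> near y (\<psi> r)} \<in> sets borel" for y
    by measurable
  have eq: "simul y y' \<psi> q \<inter> simul y y' \<psi> r =
      {x. real q * x \<in> near y (\<psi> q) \<and> real r * x \<in> near y (\<psi> r)} \<times>
      {x. real q * x \<in> near y' (\<psi> q) \<and> real r * x \<in> near y' (\<psi> r)}"
    unfolding simul_def by auto
  have "emeasure unif2 (simul y y' \<psi> q \<inter> simul y y' \<psi> r) \<le> ennreal c * ennreal c"
    unfolding eq c_def by (subst unif.emeasure_pair_measure_Times)
      (auto intro!: mult_mono emeasure_unif_near_overlap_le[OF q r \<psi>])
  also have "\<dots> = ennreal (c\<^sup>2)" using c by (simp add: ennreal_mult power2_eq_square)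
  finally show ?thesis unfolding c_def[symmetric] using c
    by (simp add: unif2.P.emeasure_eq_measure)
qed

text \<open>The difference of the two sides is \<open>(e * x - y)\<^sup>2 / e\<close>. The weights
  keep the coefficient of the main term close to 1, at the price of a large one on the error
  term.\<close>

lemma square_add_le:
  fixes x y e :: real
  assumes "0 < e"
  shows "(x + y)\<^sup>2 \<le> (1 + e) * x\<^sup>2 + (1 + 1 / e) * y\<^sup>2"
proof -
  have "0 \<le> (e * x - y)\<^sup>2 / e" using assms by simp
  also have "(e * x - y)\<^sup>2 / e = (1 + e) * x\<^sup>2 + (1 + 1 / e) * y\<^sup>2 - (x + y)\<^sup>2"
    using assms by (simp add: field_simps power2_eq_square)
  finally show ?thesis by simp
qed

text \<open>The overlap bound is split by \<open>square_add_le\<close>. The main terms add up to the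
  square of the total probability, and the gcd terms are summed first over \<open>q \<le> r\<close>,
  where \<open>r / totient r \<le> H\<close> controls them.\<close>

lemma sum_prob_simul_Int_le:
  assumes \<psi>: "\<And>q. 0 \<le> \<psi> q" "\<And>q. \<psi> q \<le> 1 / 2" and I: "finite I" "0 \<notin> I" and e: "0 < e"
    and H: "\<And>q. q \<in> I \<Longrightarrow> real q / real (totient q) \<le> H"
  shows "(\<Sum>q\<in>I. \<Sum>r\<in>I. measure unif2 (simul y y' \<psi> q \<inter> simul y y' \<psi> r))
    \<le> (1 + e) * (16 * (\<Sum>q\<in>I. (\<psi> q)\<^sup>2)\<^sup>2) + (1 + 1 / e) * (8 * H * (\<Sum>q\<in>I. (\<psi> q)\<^sup>2))"
proof -
  define T where "T = (\<Sum>q\<in>I. (\<psi> q)\<^sup>2)"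
  \<comment> \<open>The overlap bound needs the larger index in second place;
    \<open>G q r + G r q\<close> is a symmetric majorant serving both orders, whence 8 = 2 * 4 in
    the result.\<close>
  define G where "G = (\<lambda>q r. if q \<le> r then (\<psi> r * real (gcd q r) / real r)\<^sup>2 else 0)"
  have G0: "0 \<le> G q r" for q r by (simp add: G_def)
  have bound: "measure unif2 (simul y y' \<psi> q \<inter> simul y y' \<psi> r)
      \<le> (1 + e) * (16 * ((\<psi> q)\<^sup>2 * (\<psi> r)\<^sup>2)) + (1 + 1 / e) * (4 * (G q r + G r q))"
    if qr: "q \<in> I" "r \<in> I" for q r
  proof -
    have main: "measure unif2 (simul y y' \<psi> q \<inter> simul y y' \<psi> r)
        \<le> (1 + e) * (16 * ((\<psi> q)\<^sup>2 * (\<psi> r)\<^sup>2)) + (1 + 1 / e) * (4 * G q r)"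
      if "q \<in> I" "r \<in> I" "q \<le> r" for q r
    proof -
      have pos: "0 < q" "0 < r" using I that by (metis gr0I)+
      have "measure unif2 (simul y y' \<psi> q \<inter> simul y y' \<psi> r)
          \<le> (4 * \<psi> q * \<psi> r + 2 * \<psi> r * real (gcd q r) / real r)\<^sup>2"
        using \<psi> pos by (intro prob_simul_Int_le)
      also have "\<dots> \<le> (1 + e) * (4 * \<psi> q * \<psi> r)\<^sup>2 + (1 + 1 / e) * (2 * \<psi> r * real (gcd q r) / real r)\<^sup>2"
        by (rule square_add_le[OF e])
      also have "\<dots> = (1 + e) * (16 * ((\<psi> q)\<^sup>2 * (\<psi> r)\<^sup>2)) + (1 + 1 / e) * (4 * G q r)"
        using that by (simp add: G_def power_mult_distrib power_divide mult.assoc)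
      finally show ?thesis .
    qed
    have mono: "(1 + 1 / e) * (4 * G q r) \<le> (1 + 1 / e) * (4 * (G q r + G r q))"
      "(1 + 1 / e) * (4 * G r q) \<le> (1 + 1 / e) * (4 * (G q r + G r q))"
      using e G0[of q r] G0[of r q] by (intro mult_left_mono; simp)+
    show ?thesis
    proof (cases "q \<le> r")
      case True
      then show ?thesis using main[OF qr] mono by linarith
    next
      case False
      then show ?thesis using main[OF qr(2,1)] mono by (simp add: Int_commute mult.commute[of "(\<psi> q)\<^sup>2"])
    qed
  qed
  have sumG: "(\<Sum>r\<in>I. \<Sum>q\<in>I. G q r) \<le> H * T"
  proof -
    have "(\<Sum>q\<in>I. G q r) \<le> H * (\<psi> r)\<^sup>2" if "r \<in> I" for r
    proof -
      have r: "0 < r" using I that by (metis gr0I)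
      have "(\<Sum>q\<in>I. G q r) = (\<Sum>q | q \<in> I \<and> q \<le> r. (\<psi> r)\<^sup>2 * (real (gcd q r) / real r)\<^sup>2)"
        unfolding G_def using I
        by (subst sum.inter_filter[symmetric]) (auto simp: power_mult_distrib power_divide)
      also have "\<dots> = (\<psi> r)\<^sup>2 * (\<Sum>q | q \<in> I \<and> q \<le> r. (real (gcd q r) / real r)\<^sup>2)"
        by (simp add: sum_distrib_left)
      also have "\<dots> \<le> (\<psi> r)\<^sup>2 * H"
        using sum_gcd_square_real_le[OF r I] H[OF that] by (intro mult_left_mono) auto
      finally show ?thesis by (simp add: mult.commute)
    qed
    then have "(\<Sum>r\<in>I. \<Sum>q\<in>I. G q r) \<le> (\<Sum>r\<in>I. H * (\<psi> r)\<^sup>2)" by (rule sum_mono)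
    then show ?thesis by (simp add: T_def sum_distrib_left)
  qed
  have "(\<Sum>q\<in>I. \<Sum>r\<in>I. measure unif2 (simul y y' \<psi> q \<inter> simul y y' \<psi> r))
      \<le> (\<Sum>q\<in>I. \<Sum>r\<in>I. (1 + e) * (16 * ((\<psi> q)\<^sup>2 * (\<psi> r)\<^sup>2)) + (1 + 1 / e) * (4 * (G q r + G r q)))"
    by (intro sum_mono bound)
  also have "\<dots> = (1 + e) * (16 * (\<Sum>q\<in>I. \<Sum>r\<in>I. (\<psi> q)\<^sup>2 * (\<psi> r)\<^sup>2))
      + (1 + 1 / e) * (4 * ((\<Sum>q\<in>I. \<Sum>r\<in>I. G q r) + (\<Sum>q\<in>I. \<Sum>r\<in>I. G r q)))"
    by (simp only: sum.distrib sum_distrib_left[symmetric])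
  also have "(\<Sum>q\<in>I. \<Sum>r\<in>I. G q r) = (\<Sum>r\<in>I. \<Sum>q\<in>I. G q r)" by (rule sum.swap)
  also have "(\<Sum>q\<in>I. \<Sum>r\<in>I. (\<psi> q)\<^sup>2 * (\<psi> r)\<^sup>2) = T\<^sup>2"
    by (simp add: T_def power2_eq_square[of "sum _ _"] sum_product)
  also have "(1 + e) * (16 * T\<^sup>2) + (1 + 1 / e) * (4 * ((\<Sum>r\<in>I. \<Sum>q\<in>I. G q r) + (\<Sum>q\<in>I. \<Sum>r\<in>I. G r q)))
      \<le> (1 + e) * (16 * T\<^sup>2) + (1 + 1 / e) * (4 * (H * T + H * T))"
    using sumG e by (intro add_left_mono mult_left_mono add_mono) auto
  finally show ?thesis unfolding T_def by (simp add: algebra_simps)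
qed

lemma AE_infinite_simultaneous_le_half:
  fixes \<psi> :: "nat \<Rightarrow> real"
  assumes \<psi>: "\<And>q. 0 \<le> \<psi> q" "\<And>q. \<psi> q \<le> 1 / 2" and \<epsilon>: "0 < \<epsilon>"
    and div: "\<not> summable (\<lambda>q. (real (totient q) / real q) powr (1 + \<epsilon>) * (\<psi> q)\<^sup>2)"
  shows "AE z in unif2. infinite {q\<in>{0<..}. z \<in> simul y y' \<psi> q}"
proof (rule unif2.P.AE_infinitely_many_events)
  fix F :: "nat set" and e' :: real
  assume F: "finite F" and e': "0 < e'"
  \<comment> \<open>Half of the allowance \<open>e'\<close> goes to the factor of the main term,
    half to the gcd error.\<close>
  define e where "e = e' / 2"
  have e: "0 < e" using e' by (simp add: e_def)
  define N where "N = Suc (Max (insert 0 F))"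
  have N: "q < N" if "q \<in> F" for q
    unfolding N_def less_Suc_eq_le using F that by (intro Max_ge) auto
  \<comment> \<open>Chosen so that the error \<open>(1 + 1 / e) * (8 * H * T)\<close> equals
    \<open>16 * e * T * (H * C)\<close>, which is at most \<open>16 * e * T\<^sup>2\<close> once
    \<open>H * C \<le> T\<close>.\<close>
  define C where "C = (1 + 1 / e) / (2 * e)"
  have C: "0 < C" unfolding C_def using e by (simp add: add_pos_pos)
  have "\<exists>I H. finite I \<and> I \<subseteq> {N..} \<and> 0 < H \<and> (\<forall>q\<in>I. 1 / (real (totient q) / real q) \<le> H) \<and>
      H * C \<le> (\<Sum>q\<in>I. (\<psi> q)\<^sup>2)"
    by (rule dyadic_class_sum_large[OF \<epsilon> C _ _ _ div]) (auto simp: N_def totient_le)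
  then obtain I H where I: "finite I" "I \<subseteq> {N..}" and H: "0 < H" "\<And>q. q \<in> I \<Longrightarrow> real q / real (totient q) \<le> H"
    and large: "H * C \<le> (\<Sum>q\<in>I. (\<psi> q)\<^sup>2)" by auto
  define T where "T = (\<Sum>q\<in>I. (\<psi> q)\<^sup>2)"
  have T: "0 < T" using large mult_pos_pos[OF H(1) C] unfolding T_def by linarith
  have pos: "0 < q" if "q \<in> I" for q using I that by (auto simp: N_def)
  have S: "(\<Sum>q\<in>I. measure unif2 (simul y y' \<psi> q)) = 4 * T"
    unfolding T_def sum_distrib_left using prob_simul pos \<psi> by (intro sum.cong) auto
  have "(\<Sum>q\<in>I. \<Sum>r\<in>I. measure unif2 (simul y y' \<psi> q \<inter> simul y y' \<psi> r))
      \<le> (1 + e) * (16 * T\<^sup>2) + (1 + 1 / e) * (8 * H * T)"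
    unfolding T_def using \<psi> I pos e H by (intro sum_prob_simul_Int_le) auto
  also have "(1 + 1 / e) * (8 * H * T) = 16 * e * T * (H * C)"
    unfolding C_def using e by (simp add: field_simps)
  also have "16 * e * T * (H * C) \<le> 16 * e * T * T"
    using large T e unfolding T_def[symmetric] by (intro mult_left_mono) auto
  also have "(1 + e) * (16 * T\<^sup>2) + 16 * e * T * T = (1 + e') * (4 * T)\<^sup>2"
    by (simp add: e_def power2_eq_square field_simps)
  finally have "(\<Sum>q\<in>I. \<Sum>r\<in>I. measure unif2 (simul y y' \<psi> q \<inter> simul y y' \<psi> r))
      \<le> (1 + e') * (\<Sum>q\<in>I. measure unif2 (simul y y' \<psi> q))\<^sup>2" unfolding S by simp
  moreover have "I \<subseteq> {0<..} - F"
  proof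
    fix q assume q: "q \<in> I"
    then have "N \<le> q" using I by auto
    with N[of q] pos[OF q] show "q \<in> {0<..} - F" by auto
  qed
  ultimately show "\<exists>I. finite I \<and> I \<subseteq> {0<..} - F \<and> 0 < (\<Sum>q\<in>I. measure unif2 (simul y y' \<psi> q)) \<and>
      (\<Sum>q\<in>I. \<Sum>r\<in>I. measure unif2 (simul y y' \<psi> q \<inter> simul y y' \<psi> r))
      \<le> (1 + e') * (\<Sum>q\<in>I. measure unif2 (simul y y' \<psi> q))\<^sup>2"
    using I T S by (intro exI[of _ I] conjI) simp_all
qed (rule sets_simul)

section \<open>Radii exceeding 1/2\<close>

lemma near_mono: "\<delta> \<le> \<eta> \<Longrightarrow> near y \<delta> \<subseteq> near y \<eta>"
  unfolding near_def by (auto intro: less_le_trans)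

text \<open>Truncation at 1/2 preserves divergence: if the truncated series converged, its terms
  would tend to 0, and since \<open>totient q \<ge> 1\<close> for \<open>q > 0\<close> the
  truncation would eventually be inactive.\<close>

lemma AE_infinite_linear_forms:
  fixes \<psi> :: "nat \<Rightarrow> real"
  assumes \<psi>: "\<And>q. 0 \<le> \<psi> q" and div: "\<not> summable (\<lambda>q. real (totient q) * \<psi> q)"
  shows "AE z in unif2. infinite {i\<in>{(a, k). a \<in> totatives k}.
    z \<in> {z. real (fst i) * fst z + real (snd i) * snd z \<in> near y (\<psi> (snd i))}}"
proof -
  define \<theta> where "\<theta> = (\<lambda>q. min (\<psi> q) (1 / 2))"
  have "\<not> summable (\<lambda>q. real (totient q) * \<theta> q)"
  proof
    assume sum: "summable (\<lambda>q. real (totient q) * \<theta> q)"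
    then have "(\<lambda>q. real (totient q) * \<theta> q) \<longlonglongrightarrow> 0" by (rule summable_LIMSEQ_zero)
    then have "eventually (\<lambda>q. real (totient q) * \<theta> q < 1 / 2) sequentially"
      by (rule order_tendstoD) simp
    then have ev: "eventually (\<lambda>q. real (totient q) * \<theta> q = real (totient q) * \<psi> q) sequentially"
      using eventually_gt_at_top[of 0]
    proof eventually_elim
      case (elim q)
      then have "1 \<le> real (totient q)" by (simp add: Suc_le_eq)
      then have "\<theta> q \<le> real (totient q) * \<theta> q"
        using mult_right_mono[of 1 "real (totient q)" "\<theta> q"] \<psi>[of q] by (simp add: \<theta>_def)
      then show ?case using elim by (auto simp: \<theta>_def min_def split: if_splits)
    qed
    have "summable (\<lambda>q. real (totient q) * \<psi> q)" using sum summable_cong[OF ev] by blast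
    with div show False by simp
  qed
  then have "AE z in unif2. infinite {i\<in>{(a, k). a \<in> totatives k}.
      z \<in> {z. real (fst i) * fst z + real (snd i) * snd z \<in> near y (\<theta> (snd i))}}"
    using \<psi> by (intro AE_infinite_linear_forms_le_half) (auto simp: \<theta>_def)
  moreover have "near y (\<theta> q) \<subseteq> near y (\<psi> q)" for q by (rule near_mono) (simp add: \<theta>_def)
  ultimately show ?thesis by (auto elim!: eventually_mono infinite_super[rotated])
qed

text \<open>The weights \<open>totient q / q\<close> have no positive lower bound, so truncation
  alone might destroy divergence. But if infinitely many radii exceed 1/2, those events are the
  whole plane; otherwise truncation changes finitely many terms.\<close>

lemma AE_infinite_simultaneous:
  fixes \<psi> :: "nat \<Rightarrow> real"
  assumes \<psi>: "\<And>q. 0 \<le> \<psi> q" and \<epsilon>: "0 < \<epsilon>"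
    and div: "\<not> summable (\<lambda>q. (real (totient q) / real q) powr (1 + \<epsilon>) * (\<psi> q)\<^sup>2)"
  shows "AE z in unif2. infinite {q\<in>{0<..}. z \<in> simul y y' \<psi> q}"
proof (cases "\<exists>\<^sub>\<infinity>q. 1 / 2 < \<psi> q")
  case True
  have "infinite {q\<in>{0<..}. z \<in> simul y y' \<psi> q}" for z
  proof -
    have "infinite ({q. 1 / 2 < \<psi> q} - {0})" using True by (simp add: frequently_cofinite)
    moreover have "{q. 1 / 2 < \<psi> q} - {0} \<subseteq> {q\<in>{0<..}. z \<in> simul y y' \<psi> q}"
      by (cases z) (auto simp: simul_def near_eq_UNIV)
    ultimately show ?thesis by (rule infinite_super[rotated])
  qed
  then show ?thesis by simp
next
  case False
  define \<theta> where "\<theta> = (\<lambda>q. min (\<psi> q) (1 / 2))"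
  have "eventually (\<lambda>q. \<psi> q \<le> 1 / 2) sequentially"
    using False by (simp add: not_frequently not_less cofinite_eq_sequentially)
  then have "eventually (\<lambda>q. (real (totient q) / real q) powr (1 + \<epsilon>) * (\<theta> q)\<^sup>2
      = (real (totient q) / real q) powr (1 + \<epsilon>) * (\<psi> q)\<^sup>2) sequentially"
    by eventually_elim (simp add: \<theta>_def min_def)
  then have "\<not> summable (\<lambda>q. (real (totient q) / real q) powr (1 + \<epsilon>) * (\<theta> q)\<^sup>2)"
    using div by (subst summable_cong)
  then have "AE z in unif2. infinite {q\<in>{0<..}. z \<in> simul y y' \<theta> q}"
    using \<psi> \<epsilon> by (intro AE_infinite_simultaneous_le_half[OF _ _ \<epsilon>]) (auto simp: \<theta>_def)
  moreover have "simul y y' \<theta> q \<subseteq> simul y y' \<psi> q" for q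
    using near_mono[of "\<theta> q" "\<psi> q"] unfolding simul_def \<theta>_def by auto
  ultimately show ?thesis by (auto elim!: eventually_mono infinite_super[rotated])
qed

section \<open>Transfer to matrices\<close>

text \<open>The closed square differs from the half-open one, which carries \<open>unif2\<close>, by
  a null set, and \<open>T\<close> preserves measure. \<open>A\<close> is not assumed measurable; it
  is the preimage of the closed square minus a null set of the completion.\<close>

lemma emeasure_lebesgue_eq_1_transfer:
  fixes T :: "'a::euclidean_space \<Rightarrow> real \<times> real"
  assumes T: "T \<in> borel_measurable borel" "distr lborel borel T = lborel"
    and A: "A \<subseteq> T -` ({0..1} \<times> {0..1})" and P: "AE z in unif2. P z"
    and PA: "\<And>x. T x \<in> {0..1} \<times> {0..1} \<Longrightarrow> P (T x) \<Longrightarrow> x \<in> A"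
  shows "emeasure lebesgue A = 1"
proof -
  define B C where "B = T -` ({0..<1} \<times> {0..<1})" and "C = T -` ({0..1} \<times> {0..1})"
  have borel2: "{0..<1} \<times> {0..<1} \<in> sets (borel :: (real \<times> real) measure)"
    "{0..1} \<times> {0..1} \<in> sets (borel :: (real \<times> real) measure)"
    by (auto simp: borel_prod[symmetric] intro!: pair_measureI)
  have "emeasure lborel ({0..<1::real} \<times> {0..<1::real}) = 1" "emeasure lborel ({0..1::real} \<times> {0..1::real}) = 1"
    by (auto simp: lborel_prod[symmetric] lborel.emeasure_pair_measure_Times)
  then have emB: "emeasure lborel B = 1" and emC: "emeasure lborel C = 1"
    using T borel2 unfolding B_def C_def by (metis emeasure_distr measurable_lborel2 sets_lborel space_lborel vimage_UNIV Int_UNIV_right space_borel)+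
  have B: "B \<in> sets lborel" and C: "C \<in> sets lborel"
    using measurable_sets[OF T(1) borel2(1)] measurable_sets[OF T(1) borel2(2)] by (auto simp: B_def C_def)
  have BC: "B \<subseteq> C" by (auto simp: B_def C_def)
  have CB: "C - B \<in> null_sets lborel"
    using emeasure_Diff[of lborel B C] BC C B emB emC by (auto intro: null_setsI)
  have "AE z in lborel. z \<in> {0..<1} \<times> {0..<1} \<longrightarrow> P z"
    using P borel2 unfolding unif2_eq_density by (subst (asm) AE_density) (auto simp: indicator_def)
  then have "AE x in lborel. T x \<in> {0..<1} \<times> {0..<1} \<longrightarrow> P (T x)"
    using T by (subst (asm) T(2)[symmetric]) (rule AE_distrD[of T], auto)
  then obtain N where N: "N \<in> null_sets lborel" "{x. \<not> (T x \<in> {0..<1} \<times> {0..<1} \<longrightarrow> P (T x))} \<subseteq> N"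
    by (auto simp: eventually_ae_filter)
  have "(C - B) \<union> N \<in> null_sets lborel" using CB N(1) by (rule null_sets.Un)
  moreover have "C - A \<subseteq> (C - B) \<union> N"
  proof
    fix x assume x: "x \<in> C - A"
    then have nP: "\<not> P (T x)" using PA[of x] unfolding C_def by (metis DiffD1 DiffD2 vimageD)
    show "x \<in> (C - B) \<union> N"
    proof (cases "x \<in> B")
      case True
      then have "x \<in> {x. \<not> (T x \<in> {0..<1} \<times> {0..<1} \<longrightarrow> P (T x))}"
        using nP unfolding B_def by (simp only: vimage_eq mem_Collect_eq simp_thms)
      then have "x \<in> N" by (rule subsetD[OF N(2)])
      then show ?thesis by (rule UnI2)
    next
      case False
      then show ?thesis using x by (simp only: Un_iff Diff_iff simp_thms)
    qed
  qed
  ultimately have null: "C - A \<in> null_sets lebesgue"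
    by (metis null_sets_completion_subset null_sets_completionI)
  have "A = C - (C - A)" using A by (auto simp: C_def)
  then have "emeasure lebesgue A = emeasure lebesgue (C - (C - A))" by simp
  also have "\<dots> = emeasure lebesgue C"
    using null C by (intro emeasure_Diff_null_set) (auto intro: sets_completionI_sets)
  also have "\<dots> = 1" using emC C by (simp add: emeasure_completion)
  finally show ?thesis .
qed

lemma Basis_real_1_2: "(Basis :: (real ^ 1 ^ 2) set) = {axis 1 (axis 1 1), axis 2 (axis 1 1)}"
  by (auto simp: Basis_vec_def UNIV_2 UNIV_1)

lemma Basis_real_2_1: "(Basis :: (real ^ 2 ^ 1) set) = {axis 1 (axis 1 1), axis 1 (axis 2 1)}"
  by (auto simp: Basis_vec_def UNIV_2 UNIV_1)

text \<open>Lebesgue measure is determined by its values on boxes, and the coordinate map pulls a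
  box back to the box with corners \<open>L\<close> and \<open>U\<close> and the same side
  lengths.\<close>

lemma lborel_eq_distr_coordinates:
  fixes T :: "'a::euclidean_space \<Rightarrow> real \<times> real"
  assumes T: "T = (\<lambda>x. (x \<bullet> b, x \<bullet> c))" and B: "Basis = {b, c}" "b \<noteq> c"
  shows "T \<in> borel_measurable borel" and "distr lborel borel T = lborel"
proof -
  show meas: "T \<in> borel_measurable borel" unfolding T by measurable
  show "distr lborel borel T = lborel"
  proof (rule lborel_eqI[symmetric])
    fix l u :: "real \<times> real"
    assume le: "\<And>i. i \<in> Basis \<Longrightarrow> l \<bullet> i \<le> u \<bullet> i"
    have lu: "fst l \<le> fst u" "snd l \<le> snd u"
      using le[of "(1, 0)"] le[of "(0, 1)"] by (auto simp: Basis_prod_def inner_prod_def)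
    define L U where "L = fst l *\<^sub>R b + snd l *\<^sub>R c" and "U = fst u *\<^sub>R b + snd u *\<^sub>R c"
    have bc: "b \<in> Basis" "c \<in> Basis" using B by auto
    have in1: "b \<bullet> b = 1" "c \<bullet> c = 1" "b \<bullet> c = 0" "c \<bullet> b = 0"
      using inner_Basis[OF bc(1) bc(1)] inner_Basis[OF bc(2) bc(2)] inner_Basis[OF bc] inner_Basis[OF bc(2,1)] B(2) by auto
    have LU: "L \<bullet> b = fst l" "L \<bullet> c = snd l" "U \<bullet> b = fst u" "U \<bullet> c = snd u"
      unfolding L_def U_def by (simp_all add: inner_add_left in1)
    have "T -` box l u = box L U"
      unfolding T by (auto simp: box_def B LU Basis_prod_def inner_prod_def)
    then have "emeasure (distr lborel borel T) (box l u) = emeasure lborel (box L U)"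
      using meas by (subst emeasure_distr) auto
    also have "\<dots> = (\<Prod>i\<in>Basis. (U - L) \<bullet> i)"
      using lu by (intro emeasure_lborel_box) (auto simp: B LU)
    also have "(\<Prod>i\<in>Basis. (U - L) \<bullet> i) = (fst u - fst l) * (snd u - snd l)"
      using B(2) by (simp add: B(1) inner_diff_left LU)
    also have "\<dots> = (\<Prod>i\<in>Basis. (u - l) \<bullet> i)"
      by (simp add: Basis_prod_def inner_prod_def)
    finally show "emeasure (distr lborel borel T) (box l u) = ennreal (\<Prod>i\<in>Basis. (u - l) \<bullet> i)" .
  qed simp
qed

section \<open>Membership in the limsup sets\<close>

lemma infinite_if_infinite_snd:
  assumes "infinite S" "inj_on v S" "\<And>i. i \<in> S \<Longrightarrow> \<exists>p. (p, v i) \<in> X"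
  shows "infinite X"
proof
  assume "finite X"
  moreover have "v ` S \<subseteq> snd ` X" using assms(3) by force
  ultimately have "finite (v ` S)" by (meson finite_imageI finite_subset)
  with assms show False by (simp add: finite_image_iff)
qed

lemma approx_set_2_1I:
  fixes x :: "real ^ 1 ^ 2" and y :: "real ^ 1"
  assumes x: "x \<in> unit_cube" and inf: "infinite {i\<in>{(a, k). a \<in> totatives k}.
    real (fst i) * (x $ 1 $ 1) + real (snd i) * (x $ 2 $ 1) \<in> near (y $ 1) (\<psi> (snd i))}" (is "infinite ?S")
  shows "x \<in> approx_set y \<psi>"
proof -
  define v :: "nat \<times> nat \<Rightarrow> int ^ 2" where "v = (\<lambda>i. \<chi> j. if j = 1 then int (fst i) else int (snd i))"
  have v: "v i $ 1 = int (fst i)" "v i $ 2 = int (snd i)" for i by (simp_all add: v_def)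
  show ?thesis unfolding approx_set_def
  proof (rule CollectI, rule conjI[OF x], rule infinite_if_infinite_snd[OF inf])
    show "inj_on v ?S" by (rule inj_onI) (metis v of_nat_eq_iff prod_eqI)
  next
    fix i assume "i \<in> ?S"
    then have i: "fst i \<in> totatives (snd i)" and
      "real (fst i) * (x $ 1 $ 1) + real (snd i) * (x $ 2 $ 1) \<in> near (y $ 1) (\<psi> (snd i))" by auto
    then obtain p where p: "\<bar>real (fst i) * (x $ 1 $ 1) + real (snd i) * (x $ 2 $ 1) + of_int p - y $ 1\<bar> < \<psi> (snd i)"
      unfolding near_def by auto
    \<comment> \<open>A totative of \<open>k\<close> lies between 1 and \<open>k\<close>, so the max
      norm of \<open>(a, k)\<close> is \<open>k\<close> and the radius is the one used in the
      event.\<close>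
    have norm: "int_vec_norm (v i) = snd i"
      using i by (simp add: int_vec_norm_def UNIV_2 v in_totatives_iff max_def)
    have nz: "v i \<noteq> 0" using i v[of i] by (auto simp: in_totatives_iff)
    define P :: "int ^ 1" where "P = (\<chi> j. p)"
    have "((\<chi> j. of_int (v i $ j)) v* x) $ 1 = real (fst i) * (x $ 1 $ 1) + real (snd i) * (x $ 2 $ 1)"
      unfolding vector_matrix_mult_def by (simp add: sum_2 v mult.commute)
    then have "\<forall>j. \<bar>((\<chi> j. of_int (v i $ j)) v* x) $ j + of_int (P $ j) - y $ j\<bar> < \<psi> (snd i)"
      unfolding forall_1 using p by (simp only: P_def vec_lambda_beta)
    with nz have "(P, v i) \<in> {pq. let p = fst pq; q = snd pq in q \<noteq> 0 \<and>
        (\<forall>j. \<bar>((\<chi> i. of_int (q $ i)) v* x) $ j + of_int (p $ j) - y $ j\<bar> < \<psi> (int_vec_norm q))}"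
      unfolding Let_def mem_Collect_eq fst_conv snd_conv norm by blast
    then show "\<exists>p. (p, v i) \<in> {pq. let p = fst pq; q = snd pq in q \<noteq> 0 \<and>
        (\<forall>j. \<bar>((\<chi> i. of_int (q $ i)) v* x) $ j + of_int (p $ j) - y $ j\<bar> < \<psi> (int_vec_norm q))}" ..
  qed
qed

lemma approx_set_1_2I:
  fixes x :: "real ^ 2 ^ 1" and y :: "real ^ 2"
  assumes x: "x \<in> unit_cube"
    and inf: "infinite {q\<in>{0<..}. (x $ 1 $ 1, x $ 1 $ 2) \<in> simul (y $ 1) (y $ 2) \<psi> q}" (is "infinite ?S")
  shows "x \<in> approx_set y \<psi>"
proof -
  define v :: "nat \<Rightarrow> int ^ 1" where "v = (\<lambda>q. \<chi> j. int q)"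
  have v: "v q $ 1 = int q" for q by (simp add: v_def)
  show ?thesis unfolding approx_set_def
  proof (rule CollectI, rule conjI[OF x], rule infinite_if_infinite_snd[OF inf])
    show "inj_on v ?S" by (rule inj_onI) (metis v of_nat_eq_iff)
  next
    fix q assume "q \<in> ?S"
    then have q: "0 < q" and "real q * (x $ 1 $ 1) \<in> near (y $ 1) (\<psi> q)"
      "real q * (x $ 1 $ 2) \<in> near (y $ 2) (\<psi> q)" by (auto simp: simul_def)
    then obtain p1 p2 where p: "\<bar>real q * (x $ 1 $ 1) + of_int p1 - y $ 1\<bar> < \<psi> q"
      "\<bar>real q * (x $ 1 $ 2) + of_int p2 - y $ 2\<bar> < \<psi> q"
      unfolding near_def by auto
    have norm: "int_vec_norm (v q) = q" by (simp add: int_vec_norm_def UNIV_1 v)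
    have nz: "v q \<noteq> 0" using q v[of q] by auto
    define P :: "int ^ 2" where "P = (\<chi> j. if j = 1 then p1 else p2)"
    have P: "P $ 1 = p1" "P $ 2 = p2" by (simp_all add: P_def)
    have "((\<chi> i. of_int (v q $ i)) v* x) $ j = real q * (x $ 1 $ j)" for j
      by (simp add: vector_matrix_mult_def sum_1 v)
    then have "\<bar>((\<chi> i. of_int (v q $ i)) v* x) $ j + of_int (P $ j) - y $ j\<bar> < \<psi> q" for j
      using p exhaust_2[of j] by (auto simp only: P)
    with nz have "(P, v q) \<in> {pq. let p = fst pq; q = snd pq in q \<noteq> 0 \<and>
        (\<forall>j. \<bar>((\<chi> i. of_int (q $ i)) v* x) $ j + of_int (p $ j) - y $ j\<bar> < \<psi> (int_vec_norm q))}"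
      unfolding Let_def mem_Collect_eq fst_conv snd_conv norm by blast
    then show "\<exists>p. (p, v q) \<in> {pq. let p = fst pq; q = snd pq in q \<noteq> 0 \<and>
        (\<forall>j. \<bar>((\<chi> i. of_int (q $ i)) v* x) $ j + of_int (p $ j) - y $ j\<bar> < \<psi> (int_vec_norm q))}" ..
  qed
qed

lemma emeasure_approx_set_2_1:
  fixes y :: "real ^ 1"
  assumes "\<And>q. 0 \<le> \<psi> q" "\<not> summable (\<lambda>q. real (totient q) * \<psi> q)"
  shows "emeasure lebesgue (approx_set y \<psi> :: (real ^ 1 ^ 2) set) = 1"
proof -
  define T :: "real ^ 1 ^ 2 \<Rightarrow> real \<times> real" where "T = (\<lambda>x. (x \<bullet> axis 1 (axis 1 1), x \<bullet> axis 2 (axis 1 1)))"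
  have T: "T x = (x $ 1 $ 1, x $ 2 $ 1)" for x by (simp add: T_def inner_axis)
  have cube: "T x \<in> {0..1} \<times> {0..1} \<longleftrightarrow> x \<in> unit_cube" for x
    by (auto simp: T unit_cube_def forall_1 forall_2)
  have ne: "axis 1 (axis 1 1) \<noteq> (axis 2 (axis 1 1) :: real ^ 1 ^ 2)" by (simp add: axis_eq_axis)
  show ?thesis
  proof (rule emeasure_lebesgue_eq_1_transfer[OF lborel_eq_distr_coordinates[OF T_def Basis_real_1_2 ne]
        _ AE_infinite_linear_forms[OF assms, of "y $ 1"]])
    show "approx_set y \<psi> \<subseteq> T -` ({0..1} \<times> {0..1})"
      by (intro subsetI vimageI2) (simp add: cube approx_set_def)
    fix x assume "T x \<in> {0..1} \<times> {0..1}" and inf: "infinite {i\<in>{(a, k). a \<in> totatives k}.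
      T x \<in> {z. real (fst i) * fst z + real (snd i) * snd z \<in> near (y $ 1) (\<psi> (snd i))}}"
    then have "x \<in> unit_cube" unfolding cube by simp
    with inf show "x \<in> approx_set y \<psi>" by (intro approx_set_2_1I) (simp_all add: T)
  qed
qed

lemma emeasure_approx_set_1_2:
  fixes y :: "real ^ 2"
  assumes "\<And>q. 0 \<le> \<psi> q" "0 < \<epsilon>"
    "\<not> summable (\<lambda>q. (real (totient q) / real q) powr (1 + \<epsilon>) * (\<psi> q)\<^sup>2)"
  shows "emeasure lebesgue (approx_set y \<psi> :: (real ^ 2 ^ 1) set) = 1"
proof -
  define T :: "real ^ 2 ^ 1 \<Rightarrow> real \<times> real" where "T = (\<lambda>x. (x \<bullet> axis 1 (axis 1 1), x \<bullet> axis 1 (axis 2 1)))"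
  have T: "T x = (x $ 1 $ 1, x $ 1 $ 2)" for x by (simp add: T_def inner_axis)
  have cube: "T x \<in> {0..1} \<times> {0..1} \<longleftrightarrow> x \<in> unit_cube" for x
    by (auto simp: T unit_cube_def forall_1 forall_2)
  have ne: "axis 1 (axis 1 1) \<noteq> (axis 1 (axis 2 1) :: real ^ 2 ^ 1)" by (simp add: axis_eq_axis)
  show ?thesis
  proof (rule emeasure_lebesgue_eq_1_transfer[OF lborel_eq_distr_coordinates[OF T_def Basis_real_2_1 ne]
        _ AE_infinite_simultaneous[OF assms, of "y $ 1" "y $ 2"]])
    show "approx_set y \<psi> \<subseteq> T -` ({0..1} \<times> {0..1})"
      by (intro subsetI vimageI2) (simp add: cube approx_set_def)
    fix x assume "T x \<in> {0..1} \<times> {0..1}"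
      and inf: "infinite {q\<in>{0<..}. T x \<in> simul (y $ 1) (y $ 2) \<psi> q}"
    then have "x \<in> unit_cube" unfolding cube by simp
    with inf show "x \<in> approx_set y \<psi>" by (intro approx_set_1_2I) (simp_all add: T)
  qed
qed

section \<open>Comparison of the divergence conditions\<close>

theorem theorem3:
  fixes \<epsilon> :: real
  assumes "\<epsilon> > 0"
  shows "(\<forall>(\<psi> :: nat \<Rightarrow> real) (y :: real ^ 1). (\<forall>q. \<psi> q \<ge> 0) \<longrightarrow>
            \<not> summable (\<lambda>k. let q = Suc k in
                 (real (totient q) / real q) powr (1 + \<epsilon>) * real q * \<psi> q) \<longrightarrow>
            emeasure lebesgue (approx_set y \<psi> :: (real ^ 1 ^ 2) set) = 1)
       \<and> (\<forall>(\<psi> :: nat \<Rightarrow> real) (y :: real ^ 2). (\<forall>q. \<psi> q \<ge> 0) \<longrightarrow>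
            \<not> summable (\<lambda>k. let q = Suc k in
                 (real (totient q) / real q) powr (1 + \<epsilon>) * (\<psi> q)\<^sup>2) \<longrightarrow>
            emeasure lebesgue (approx_set y \<psi> :: (real ^ 2 ^ 1) set) = 1)"
proof (intro conjI allI impI)
  fix \<psi> :: "nat \<Rightarrow> real" and y :: "real ^ 1"
  assume \<psi>: "\<forall>q. \<psi> q \<ge> 0" and div: "\<not> summable (\<lambda>k. let q = Suc k in
    (real (totient q) / real q) powr (1 + \<epsilon>) * real q * \<psi> q)"
  \<comment> \<open>The base is at most 1, so raising the exponent from 1 to
    \<open>1 + \<epsilon>\<close> only lowers the weight; the hypothesis therefore forces the series
    of \<open>totient q * \<psi> q\<close> to diverge.\<close>
  have le: "(real (totient q) / real q) powr (1 + \<epsilon>) * real q * \<psi> q \<le> real (totient q) * \<psi> q" if "0 < q" for q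
  proof -
    have "(real (totient q) / real q) powr (1 + \<epsilon>) \<le> (real (totient q) / real q) powr 1"
      using that assms totient_le[of q] by (intro powr_mono') (auto simp: divide_le_eq)
    also have "\<dots> = real (totient q) / real q" using that by simp
    finally have "(real (totient q) / real q) powr (1 + \<epsilon>) * real q \<le> real (totient q) / real q * real q"
      by (rule mult_right_mono) simp
    then show ?thesis using that \<psi> by (intro mult_right_mono) auto
  qed
  have "\<not> summable (\<lambda>q. real (totient q) * \<psi> q)"
  proof
    assume "summable (\<lambda>q. real (totient q) * \<psi> q)"
    then have "summable (\<lambda>k. real (totient (Suc k)) * \<psi> (Suc k))" by (simp only: summable_Suc_iff[of "\<lambda>q. real (totient q) * \<psi> q"])
    then have "summable (\<lambda>k. let q = Suc k in (real (totient q) / real q) powr (1 + \<epsilon>) * real q * \<psi> q)"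
      unfolding Let_def
    proof (rule summable_comparison_test'[where N = 0])
      fix k
      show "norm ((real (totient (Suc k)) / real (Suc k)) powr (1 + \<epsilon>) * real (Suc k) * \<psi> (Suc k))
          \<le> real (totient (Suc k)) * \<psi> (Suc k)"
        using le[of "Suc k"] \<psi> by (simp add: abs_mult)
    qed
    with div show False by simp
  qed
  with \<psi> show "emeasure lebesgue (approx_set y \<psi> :: (real ^ 1 ^ 2) set) = 1"
    by (intro emeasure_approx_set_2_1) auto
next
  fix \<psi> :: "nat \<Rightarrow> real" and y :: "real ^ 2"
  assume \<psi>: "\<forall>q. \<psi> q \<ge> 0" and div: "\<not> summable (\<lambda>k. let q = Suc k in
    (real (totient q) / real q) powr (1 + \<epsilon>) * (\<psi> q)\<^sup>2)"
  \<comment> \<open>Starting the series at 0 instead of 1 adds one term and leaves divergence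
    unchanged.\<close>
  have "\<not> summable (\<lambda>q. (real (totient q) / real q) powr (1 + \<epsilon>) * (\<psi> q)\<^sup>2)"
    using div unfolding Let_def by (subst (asm) summable_Suc_iff)
  with \<psi> assms show "emeasure lebesgue (approx_set y \<psi> :: (real ^ 2 ^ 1) set) = 1"
    by (intro emeasure_approx_set_1_2) auto
qed

end
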